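(* Let $(W,S)$ be an affine Coxeter system. Then $\mathcal{S}=\mathcal{E}$, i.e. every elementary root is super-elementary and conversely.
   Context: Affine means that $W$ is the affine Weyl group of a finite crystallographic root system, with $S$ its standard set of Coxeter generators. Root system: $V$ is the real vector space with basis $\{\alpha_s\mid s\in S\}$ and form $\langle\alpha_s,\alpha_t\rangle=-\cos(\pi/m_{s,t})$ ($m_{s,t}$ the order of $st$; value $-1$ if $m_{s,t}=\infty$); $W$ acts by $s\lambda=\lambda-2\langle\lambda,\alpha_s\rangle\alpha_s$; $\Phi=\{w\alpha_s\mid w\in W,s\in S\}$; $\Phi^+$ is the set of roots that are non-negative combinations of the $\alpha_s$ ($\alpha<0$ means $-\alpha\in\Phi^+$). $\Phi(w)=\{\alpha\in\Phi^+\mid w^{-1}\alpha<0\}$. A root $\beta\in\Phi^+$ dominates $\alpha\in\Phi^+$ if for all $w\in W$, $w^{-1}\beta<0$ implies $w^{-1}\alpha<0$; $\mathcal{E}$ is the set of elementary roots, i.e. those $\beta\in\Phi^+$ that dominate no $\alpha\in\Phi^+\setminus\{\beta\}$. A root $\beta\in\Phi^+$ is super-elementary if there exist $x,y\in W$ with $\Phi(x)\cap\Phi(y)=\{\beta\}$; $\mathcal{S}$ is the set of super-elementary roots. *)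

theory Defs
  imports "HOL-Analysis.Analysis" "HOL-Algebra.Algebra"
begin

section \<open>Affine Weyl groups\<close>

definition root_reflection :: "'a::euclidean_space \<Rightarrow> 'a \<Rightarrow> 'a" where
  "root_reflection \<alpha> x = x - (2 * (x \<bullet> \<alpha>) / (\<alpha> \<bullet> \<alpha>)) *\<^sub>R \<alpha>"

text \<open>Root systems are reduced, but they need not be irreducible and need not span the ambient
  space, as in Humphreys, \<^emph>\<open>Reflection groups and Coxeter groups\<close>.\<close>

definition crystallographic_root_system :: "'a::euclidean_space set \<Rightarrow> bool" where
  "crystallographic_root_system R \<longleftrightarrow>
     finite R \<and> 0 \<notin> R \<and>
     (\<forall>\<alpha>\<in>R. R \<inter> range (\<lambda>c. c *\<^sub>R \<alpha>) = {\<alpha>, - \<alpha>}) \<and>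
     (\<forall>\<alpha>\<in>R. root_reflection \<alpha> ` R = R) \<and>
     (\<forall>\<alpha>\<in>R. \<forall>\<beta>\<in>R. 2 * (\<alpha> \<bullet> \<beta>) / (\<beta> \<bullet> \<beta>) \<in> \<int>)"

definition nonneg_combinations :: "'a::euclidean_space set \<Rightarrow> 'a set" where
  "nonneg_combinations D = {\<Sum>\<alpha>\<in>D. c \<alpha> *\<^sub>R \<alpha> | c. \<forall>\<alpha>\<in>D. 0 \<le> c \<alpha>}"

definition simple_system :: "'a::euclidean_space set \<Rightarrow> 'a set \<Rightarrow> bool" where
  "simple_system R D \<longleftrightarrow>
     D \<subseteq> R \<and> independent D \<and>
     (\<forall>\<beta>\<in>R. \<beta> \<in> nonneg_combinations D \<or> - \<beta> \<in> nonneg_combinations D)"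

text \<open>The roots that are maximal for the root order given by the simple system: these are exactly
  the highest roots of the irreducible components of the root system, one for each component.\<close>

definition highest_roots :: "'a::euclidean_space set \<Rightarrow> 'a set \<Rightarrow> 'a set" where
  "highest_roots R D = {\<theta>\<in>R. \<forall>\<beta>\<in>R. \<beta> - \<theta> \<in> nonneg_combinations D \<longrightarrow> \<beta> = \<theta>}"

text \<open>The orthogonal reflection in the hyperplane of all x with \<open>x \<bullet> \<alpha> = k\<close>.\<close>

definition affine_reflection :: "'a::euclidean_space \<Rightarrow> real \<Rightarrow> 'a \<Rightarrow> 'a" where
  "affine_reflection \<alpha> k x = x - (2 * (x \<bullet> \<alpha> - k) / (\<alpha> \<bullet> \<alpha>)) *\<^sub>R \<alpha>"

definition affine_weyl_group :: "'a::euclidean_space set \<Rightarrow> ('a \<Rightarrow> 'a) monoid" where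
  "affine_weyl_group R =
     subgroup_generated (BijGroup UNIV) {affine_reflection \<alpha> (of_int k) | \<alpha> k. \<alpha> \<in> R}"

text \<open>The reflections in the walls of the fundamental alcove.\<close>

definition affine_generators :: "'a::euclidean_space set \<Rightarrow> 'a set \<Rightarrow> ('a \<Rightarrow> 'a) set" where
  "affine_generators R D =
     (\<lambda>\<alpha>. affine_reflection \<alpha> 0) ` D \<union> (\<lambda>\<theta>. affine_reflection \<theta> 1) ` highest_roots R D"

definition affine_coxeter_system ::
    "('g, 'b) monoid_scheme \<Rightarrow> 'g set \<Rightarrow> 'a::euclidean_space set \<Rightarrow> bool" where
  "affine_coxeter_system W S R \<longleftrightarrow>
     crystallographic_root_system R \<and> group W \<and> S \<subseteq> carrier W \<and>
     (\<exists>D \<phi>. simple_system R D \<and> \<phi> \<in> iso W (affine_weyl_group R) \<and>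
            \<phi> ` S = affine_generators R D)"


section \<open>The root system of a Coxeter system\<close>

text \<open>For a Coxeter system \<open>(W, S)\<close> of finite rank, the vector space with basis
  \<open>\<alpha>\<^sub>s\<close> (\<open>s \<in> S\<close>) consists of the coordinate functions
  vanishing outside \<open>S\<close>.\<close>

definition simple_root :: "'g \<Rightarrow> 'g \<Rightarrow> real" where
  "simple_root s = (\<lambda>t. if t = s then 1 else 0)"

text \<open>\<open>group.ord\<close> is \<open>0\<close> for elements of infinite order.\<close>

definition simple_form :: "('g, 'b) monoid_scheme \<Rightarrow> 'g \<Rightarrow> 'g \<Rightarrow> real" where
  "simple_form W s t =
     (let m = group.ord W (s \<otimes>\<^bsub>W\<^esub> t) in if m = 0 then - 1 else - cos (pi / real m))"

definition coxeter_form ::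
    "('g, 'b) monoid_scheme \<Rightarrow> 'g set \<Rightarrow> ('g \<Rightarrow> real) \<Rightarrow> ('g \<Rightarrow> real) \<Rightarrow> real" where
  "coxeter_form W S u v = (\<Sum>s\<in>S. \<Sum>t\<in>S. u s * v t * simple_form W s t)"

definition simple_reflection ::
    "('g, 'b) monoid_scheme \<Rightarrow> 'g set \<Rightarrow> 'g \<Rightarrow> ('g \<Rightarrow> real) \<Rightarrow> 'g \<Rightarrow> real" where
  "simple_reflection W S s v =
     (\<lambda>t. v t - 2 * coxeter_form W S v (simple_root s) * simple_root s t)"

text \<open>The action of \<open>W\<close> extending that of the generators: an element acts as the
  composite of the simple reflections along any word representing it. For a Coxeter system the
  result does not depend on the choice of the word.\<close>

definition act ::
    "('g, 'b) monoid_scheme \<Rightarrow> 'g set \<Rightarrow> 'g \<Rightarrow> ('g \<Rightarrow> real) \<Rightarrow> 'g \<Rightarrow> real" where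
  "act W S w =
     foldr (simple_reflection W S)
       (SOME ws. ws \<in> lists S \<and> foldr (\<lambda>s x. s \<otimes>\<^bsub>W\<^esub> x) ws \<one>\<^bsub>W\<^esub> = w)"

definition roots :: "('g, 'b) monoid_scheme \<Rightarrow> 'g set \<Rightarrow> ('g \<Rightarrow> real) set" where
  "roots W S = {act W S w (simple_root s) | w s. w \<in> carrier W \<and> s \<in> S}"

definition positive_roots :: "('g, 'b) monoid_scheme \<Rightarrow> 'g set \<Rightarrow> ('g \<Rightarrow> real) set" where
  "positive_roots W S = {\<beta> \<in> roots W S. \<forall>s\<in>S. 0 \<le> \<beta> s}"

definition is_negative ::
    "('g, 'b) monoid_scheme \<Rightarrow> 'g set \<Rightarrow> ('g \<Rightarrow> real) \<Rightarrow> bool" where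
  "is_negative W S \<alpha> \<longleftrightarrow> (\<lambda>s. - \<alpha> s) \<in> positive_roots W S"

definition inversion_set ::
    "('g, 'b) monoid_scheme \<Rightarrow> 'g set \<Rightarrow> 'g \<Rightarrow> ('g \<Rightarrow> real) set" where
  "inversion_set W S w =
     {\<alpha> \<in> positive_roots W S. is_negative W S (act W S (inv\<^bsub>W\<^esub> w) \<alpha>)}"

definition dominates ::
    "('g, 'b) monoid_scheme \<Rightarrow> 'g set \<Rightarrow> ('g \<Rightarrow> real) \<Rightarrow> ('g \<Rightarrow> real) \<Rightarrow> bool" where
  "dominates W S \<beta> \<alpha> \<longleftrightarrow>
     (\<forall>w\<in>carrier W. is_negative W S (act W S (inv\<^bsub>W\<^esub> w) \<beta>) \<longrightarrow>
                     is_negative W S (act W S (inv\<^bsub>W\<^esub> w) \<alpha>))"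

definition elementary_roots :: "('g, 'b) monoid_scheme \<Rightarrow> 'g set \<Rightarrow> ('g \<Rightarrow> real) set" where
  "elementary_roots W S =
     {\<beta> \<in> positive_roots W S. \<forall>\<alpha> \<in> positive_roots W S - {\<beta>}. \<not> dominates W S \<beta> \<alpha>}"

definition super_elementary_roots ::
    "('g, 'b) monoid_scheme \<Rightarrow> 'g set \<Rightarrow> ('g \<Rightarrow> real) set" where
  "super_elementary_roots W S =
     {\<beta> \<in> positive_roots W S.
        \<exists>x\<in>carrier W. \<exists>y\<in>carrier W. inversion_set W S x \<inter> inversion_set W S y = {\<beta>}}"

end

theory Submission
  imports Defs
begin

text \<open>Super-elementary roots are elementary in every Coxeter group, because an inversion set
  containing \<open>\<beta>\<close> contains every root dominated by \<open>\<beta>\<close>. For the converse, identify the positive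
  roots with the affine functions \<open>\<gamma> + k\<close> (\<open>\<gamma>\<close> a finite root, \<open>k\<close> an integer) that are nonnegative
  on the fundamental alcove; the inversion set of \<open>w\<close> then consists of those that are negative
  on the alcove of \<open>w\<close>. Since \<open>\<gamma> + k\<close> dominates \<open>\<gamma> + (k - 1)\<close>, for an elementary root
  \<open>\<gamma> + k\<close> the root \<open>\<gamma> + (k - 1)\<close> is negative. Now choose \<open>v\<close> orthogonal to \<open>\<gamma>\<close> and to no other finite
  root up to sign, and a point \<open>q\<close> just behind the hyperplane of \<open>\<gamma> + k\<close>. For large \<open>t\<close> every
  positive root other than \<open>\<gamma> + k\<close> is positive at \<open>q + t v\<close> or at \<open>q - t v\<close>, so the alcoves at these
  two points have only the inversion \<open>\<gamma> + k\<close> in common.\<close>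

section \<open>Crystallographic root systems with a simple system\<close>

text \<open>The roots of a Coxeter system live in a space where the simple roots are independent and
  of length 1. The simple affine roots need not be either: finite roots may have several lengths,
  and each component yields the constant function 1 as a combination of its own walls, which gives
  linear relations when \<open>R\<close> is reducible. So affine roots are matched with roots
  through coordinates that are chosen component by component and rescaled by length; the components
  are recovered from the supports of the highest roots. The matching respects the action only if the
  Coxeter form is the cosine of the angle between linear parts, which is why the orders of all
  products of two generators are computed from Cartan integers. Domination between parallel roots
  holds because constants are fixed by the group: a function that is negative on an alcove stays
  negative when 1 is subtracted. In the final count elementarity enters only through the functions
  \<gamma> + j: those with linear part -\<gamma> are positive behind the hyperplane anyway, and the
  others are handled by moving along v.\<close>

locale based_root_system =
  fixes R D :: "'a::euclidean_space set"
  assumes crystallographic: "crystallographic_root_system R"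
    and simple: "simple_system R D"
begin

lemma finite_R: "finite R" and zero_notin_R: "0 \<notin> R"
  using crystallographic by (auto simp: crystallographic_root_system_def)

lemma inner_self_pos: "\<alpha> \<in> R \<Longrightarrow> 0 < \<alpha> \<bullet> \<alpha>"
  using zero_notin_R by (auto simp: inner_gt_zero_iff)

lemma uminus_in_R: "\<alpha> \<in> R \<Longrightarrow> - \<alpha> \<in> R"
  using crystallographic unfolding crystallographic_root_system_def by blast

lemma proportional_roots:
  assumes "\<alpha> \<in> R" "c *\<^sub>R \<alpha> \<in> R"
  shows "c = 1 \<or> c = -1"
proof -
  have "c *\<^sub>R \<alpha> \<in> R \<inter> range (\<lambda>c. c *\<^sub>R \<alpha>)"
    using assms by blast
  then have "c *\<^sub>R \<alpha> = \<alpha> \<or> c *\<^sub>R \<alpha> = - \<alpha>"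
    using crystallographic \<open>\<alpha> \<in> R\<close> unfolding crystallographic_root_system_def by blast
  then have "(c - 1) *\<^sub>R \<alpha> = 0 \<or> (c + 1) *\<^sub>R \<alpha> = 0"
    by (auto simp: algebra_simps)
  then show ?thesis
    using zero_notin_R assms(1) by auto
qed

lemma reflection_in_R:
  assumes "\<alpha> \<in> R" "\<gamma> \<in> R"
  shows "\<gamma> - (2 * (\<gamma> \<bullet> \<alpha>) / (\<alpha> \<bullet> \<alpha>)) *\<^sub>R \<alpha> \<in> R"
  using crystallographic assms
  unfolding crystallographic_root_system_def root_reflection_def by blast

lemma cartan_integer: "\<alpha> \<in> R \<Longrightarrow> \<beta> \<in> R \<Longrightarrow> 2 * (\<alpha> \<bullet> \<beta>) / (\<beta> \<bullet> \<beta>) \<in> \<int>"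
  using crystallographic unfolding crystallographic_root_system_def by blast

section \<open>Cartan integers of two roots\<close>

lemma strict_Cauchy_Schwarz:
  assumes "\<alpha> \<in> R" "\<beta> \<in> R" "\<beta> \<noteq> \<alpha>" "\<beta> \<noteq> - \<alpha>"
  shows "(\<alpha> \<bullet> \<beta>)\<^sup>2 < (\<alpha> \<bullet> \<alpha>) * (\<beta> \<bullet> \<beta>)"
proof (rule ccontr)
  assume "\<not> ?thesis"
  then have eq: "(\<alpha> \<bullet> \<beta>)\<^sup>2 = (\<alpha> \<bullet> \<alpha>) * (\<beta> \<bullet> \<beta>)"
    using Cauchy_Schwarz_ineq[of \<alpha> \<beta>] by linarith
  define c where "c = (\<alpha> \<bullet> \<beta>) / (\<alpha> \<bullet> \<alpha>)"
  have "(\<beta> - c *\<^sub>R \<alpha>) \<bullet> (\<beta> - c *\<^sub>R \<alpha>) = \<beta> \<bullet> \<beta> - 2 * c * (\<alpha> \<bullet> \<beta>) + c\<^sup>2 * (\<alpha> \<bullet> \<alpha>)"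
    by (simp add: inner_diff_left inner_diff_right inner_commute power2_eq_square algebra_simps)
  also have "\<dots> = 0"
    using inner_self_pos[OF assms(1)] eq
    by (simp add: c_def power2_eq_square field_simps)
  finally have "\<beta> = c *\<^sub>R \<alpha>"
    by simp
  then show False
    using proportional_roots[of \<alpha> c] assms by auto
qed

text \<open>The product of the two Cartan integers is four times the squared cosine of the angle,
  and strict Cauchy-Schwarz keeps that square below 1 for non-proportional roots.\<close>

lemma cartan_product:
  assumes "\<alpha> \<in> R" "\<beta> \<in> R" "\<alpha> \<bullet> \<beta> \<noteq> 0" "\<beta> \<noteq> \<alpha>" "\<beta> \<noteq> - \<alpha>"
  obtains m n :: int where "2 * (\<alpha> \<bullet> \<beta>) / (\<alpha> \<bullet> \<alpha>) = m" "2 * (\<alpha> \<bullet> \<beta>) / (\<beta> \<bullet> \<beta>) = n"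
    "0 < m * n" "m * n < 4"
proof -
  obtain m n :: int where mn: "2 * (\<alpha> \<bullet> \<beta>) / (\<alpha> \<bullet> \<alpha>) = m" "2 * (\<alpha> \<bullet> \<beta>) / (\<beta> \<bullet> \<beta>) = n"
    using cartan_integer[OF assms(1,2)] cartan_integer[OF assms(2,1)]
    by (metis Ints_cases inner_commute)
  have prod: "of_int (m * n) = 4 * ((\<alpha> \<bullet> \<beta>)\<^sup>2 / ((\<alpha> \<bullet> \<alpha>) * (\<beta> \<bullet> \<beta>)))"
    by (simp add: mn[symmetric] power2_eq_square)
  have "0 < (\<alpha> \<bullet> \<beta>)\<^sup>2 / ((\<alpha> \<bullet> \<alpha>) * (\<beta> \<bullet> \<beta>))" "(\<alpha> \<bullet> \<beta>)\<^sup>2 / ((\<alpha> \<bullet> \<alpha>) * (\<beta> \<bullet> \<beta>)) < 1"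
    using strict_Cauchy_Schwarz[of \<alpha> \<beta>] inner_self_pos assms by auto
  then have "0 < real_of_int (m * n)" "real_of_int (m * n) < 4"
    unfolding prod by auto
  then show thesis
    using that[OF mn] by linarith
qed

text \<open>At an acute angle both Cartan integers are positive with product below 4, so one of them
  is 1, and reflecting one root in the other subtracts it exactly once.\<close>

lemma diff_in_R:
  assumes "\<alpha> \<in> R" "\<beta> \<in> R" "0 < \<alpha> \<bullet> \<beta>" "\<alpha> \<noteq> \<beta>"
  shows "\<alpha> - \<beta> \<in> R"
proof -
  have "\<alpha> \<bullet> \<beta> \<noteq> 0" "\<beta> \<noteq> \<alpha>"
    using assms(3,4) by auto
  moreover have "\<beta> \<noteq> - \<alpha>"
    using assms(3) not_less[of "\<alpha> \<bullet> \<alpha>" 0] by auto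
  ultimately obtain m n :: int where mn: "2 * (\<alpha> \<bullet> \<beta>) / (\<alpha> \<bullet> \<alpha>) = m" "2 * (\<alpha> \<bullet> \<beta>) / (\<beta> \<bullet> \<beta>) = n"
    and "m * n < 4"
    using cartan_product[OF assms(1,2)] by blast
  have "0 < real_of_int m" "0 < real_of_int n"
    unfolding mn[symmetric] using assms inner_self_pos by auto
  then have "m = 1 \<or> n = 1"
    using \<open>m * n < 4\<close> mult_mono[of 2 m 2 n] by force
  then show ?thesis
  proof
    assume "n = 1"
    then show ?thesis
      using reflection_in_R[OF assms(2,1)] mn by simp
  next
    assume "m = 1"
    then have "\<beta> - \<alpha> \<in> R"
      using reflection_in_R[OF assms(1,2)] mn by (simp add: inner_commute)
    then show ?thesis
      using uminus_in_R by fastforce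
  qed
qed

section \<open>Coordinates with respect to the simple roots\<close>

lemma D_subset: "D \<subseteq> R" and independent_D: "independent D"
  using simple by (auto simp: simple_system_def)

lemma finite_D: "finite D"
  using D_subset finite_R finite_subset by blast

text \<open>A functional dual to the basis \<open>D\<close>, defined on the whole ambient space. Off
  the span of \<open>D\<close> its values are arbitrary, which is why
  \<open>nonneg_combinations_iff\<close> keeps the expansion of \<open>x\<close> as a
  conjunct.\<close>

definition coord :: "'a \<Rightarrow> 'a \<Rightarrow> real" where
  "coord \<alpha> = (SOME g. linear g \<and> (\<forall>\<beta>\<in>D. g \<beta> = (if \<beta> = \<alpha> then 1 else 0)))"

lemma linear_coord: "linear (coord \<alpha>)"
  and coord_simple: "\<beta> \<in> D \<Longrightarrow> coord \<alpha> \<beta> = (if \<beta> = \<alpha> then 1 else 0)"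
proof -
  have "\<exists>g. linear g \<and> (\<forall>\<beta>\<in>D. g \<beta> = (if \<beta> = \<alpha> then 1 else (0::real)))"
    by (rule linear_independent_extend[OF independent_D])
  then have "linear (coord \<alpha>) \<and> (\<forall>\<beta>\<in>D. coord \<alpha> \<beta> = (if \<beta> = \<alpha> then 1 else 0))"
    unfolding coord_def by (rule someI_ex)
  then show "linear (coord \<alpha>)" "\<beta> \<in> D \<Longrightarrow> coord \<alpha> \<beta> = (if \<beta> = \<alpha> then 1 else 0)"
    by blast+
qed

lemmas coord_linear_simps =
  linear_add[OF linear_coord] linear_diff[OF linear_coord] linear_neg[OF linear_coord]
  linear_cmul[OF linear_coord] linear_0[OF linear_coord]

lemma coord_sum: "\<alpha> \<in> D \<Longrightarrow> coord \<alpha> (\<Sum>\<beta>\<in>D. c \<beta> *\<^sub>R \<beta>) = c \<alpha>"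
  by (simp add: linear_sum[OF linear_coord] linear_cmul[OF linear_coord] coord_simple
      finite_D if_distrib[of "\<lambda>x. _ * x"] cong: if_cong)

lemma nonneg_combinations_iff:
  "x \<in> nonneg_combinations D \<longleftrightarrow> (\<Sum>\<beta>\<in>D. coord \<beta> x *\<^sub>R \<beta>) = x \<and> (\<forall>\<beta>\<in>D. 0 \<le> coord \<beta> x)"
proof
  assume "x \<in> nonneg_combinations D"
  then obtain c where c: "x = (\<Sum>\<alpha>\<in>D. c \<alpha> *\<^sub>R \<alpha>)" "\<forall>\<alpha>\<in>D. 0 \<le> c \<alpha>"
    by (auto simp: nonneg_combinations_def)
  then have "\<forall>\<alpha>\<in>D. coord \<alpha> x = c \<alpha>"
    using coord_sum by blast
  then show "(\<Sum>\<beta>\<in>D. coord \<beta> x *\<^sub>R \<beta>) = x \<and> (\<forall>\<beta>\<in>D. 0 \<le> coord \<beta> x)"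
    using c by simp
next
  assume *: "(\<Sum>\<beta>\<in>D. coord \<beta> x *\<^sub>R \<beta>) = x \<and> (\<forall>\<beta>\<in>D. 0 \<le> coord \<beta> x)"
  show "x \<in> nonneg_combinations D"
    unfolding nonneg_combinations_def using *[THEN conjunct1, symmetric] *[THEN conjunct2]
    by (intro CollectI exI[of _ "\<lambda>\<beta>. coord \<beta> x"] conjI)
qed

lemma root_sign: "\<gamma> \<in> R \<Longrightarrow> \<gamma> \<in> nonneg_combinations D \<or> - \<gamma> \<in> nonneg_combinations D"
  using simple unfolding simple_system_def by blast

lemma nonneg_combinations_antisym:
  "x \<in> nonneg_combinations D \<Longrightarrow> - x \<in> nonneg_combinations D \<Longrightarrow> x = 0"
proof -
  assume "x \<in> nonneg_combinations D" "- x \<in> nonneg_combinations D"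
  then have "\<forall>\<beta>\<in>D. coord \<beta> x = 0" and x: "(\<Sum>\<beta>\<in>D. coord \<beta> x *\<^sub>R \<beta>) = x"
    unfolding nonneg_combinations_iff by (force simp: coord_linear_simps)+
  then have "(\<Sum>\<beta>\<in>D. coord \<beta> x *\<^sub>R \<beta>) = 0"
    by simp
  then show "x = 0"
    using x by simp
qed

lemma nonneg_combinations_add:
  "x \<in> nonneg_combinations D \<Longrightarrow> y \<in> nonneg_combinations D \<Longrightarrow> x + y \<in> nonneg_combinations D"
  unfolding nonneg_combinations_iff
  by (simp add: coord_linear_simps scaleR_left_distrib sum.distrib)

lemma coord_expansion: "\<gamma> \<in> R \<Longrightarrow> (\<Sum>\<beta>\<in>D. coord \<beta> \<gamma> *\<^sub>R \<beta>) = \<gamma>"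
  using root_sign[of \<gamma>] unfolding nonneg_combinations_iff
  by (auto simp: coord_linear_simps sum_negf)

lemma inner_root_expansion: "\<gamma> \<in> R \<Longrightarrow> \<gamma> \<bullet> x = (\<Sum>\<beta>\<in>D. coord \<beta> \<gamma> * (\<beta> \<bullet> x))"
  by (subst coord_expansion[symmetric], assumption) (simp add: inner_sum_left)

lemma simple_nonneg: "\<alpha> \<in> D \<Longrightarrow> \<alpha> \<in> nonneg_combinations D"
  unfolding nonneg_combinations_iff using coord_expansion[of \<alpha>] D_subset by (auto simp: coord_simple[of \<alpha>])

text \<open>Were the product positive, \<alpha> - \<beta> would be a root with coordinates 1 and
  -1.\<close>

lemma simple_inner_nonpos:
  assumes "\<alpha> \<in> D" "\<beta> \<in> D" "\<alpha> \<noteq> \<beta>"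
  shows "\<alpha> \<bullet> \<beta> \<le> 0"
proof (rule ccontr)
  assume "\<not> \<alpha> \<bullet> \<beta> \<le> 0"
  then have "\<alpha> - \<beta> \<in> R"
    using assms D_subset by (intro diff_in_R) auto
  then consider "0 \<le> coord \<beta> (\<alpha> - \<beta>)" | "0 \<le> coord \<alpha> (- (\<alpha> - \<beta>))"
    using root_sign assms unfolding nonneg_combinations_iff by blast
  then show False
    using assms by cases (auto simp: coord_linear_simps coord_simple)
qed

section \<open>Highest roots and the components of the root system\<close>

abbreviation "H \<equiv> highest_roots R D"

lemma H_subset: "H \<subseteq> R"
  by (auto simp: highest_roots_def)

lemma highest_rootD: "\<theta> \<in> H \<Longrightarrow> \<beta> \<in> R \<Longrightarrow> \<beta> - \<theta> \<in> nonneg_combinations D \<Longrightarrow> \<beta> = \<theta>"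
  by (auto simp: highest_roots_def)

lemma highest_nonneg:
  assumes "\<theta> \<in> H" shows "\<theta> \<in> nonneg_combinations D"
proof (rule ccontr)
  assume "\<theta> \<notin> nonneg_combinations D"
  then have "- \<theta> \<in> nonneg_combinations D"
    using root_sign H_subset assms by blast
  then have "- \<theta> - \<theta> \<in> nonneg_combinations D"
    using nonneg_combinations_add by fastforce
  then have "- \<theta> = \<theta>"
    using highest_rootD assms H_subset uminus_in_R by blast
  then have "\<theta> = 0"
    using nonneg_combinations_antisym[of \<theta>] \<open>- \<theta> \<in> nonneg_combinations D\<close> by simp
  then show False
    using assms H_subset zero_notin_R by auto
qed

text \<open>An obtuse angle would make \<theta> + \<alpha> a root strictly above \<theta>.\<close>

lemma highest_dominant:
  assumes "\<theta> \<in> H" "\<alpha> \<in> D" shows "0 \<le> \<theta> \<bullet> \<alpha>"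
proof (rule ccontr)
  assume neg: "\<not> 0 \<le> \<theta> \<bullet> \<alpha>"
  have "\<alpha> \<noteq> - \<theta>"
    using highest_nonneg[OF assms(1)] simple_nonneg[OF assms(2)] zero_notin_R H_subset assms(1)
      nonneg_combinations_antisym[of \<theta>] by auto
  then have "\<theta> - (- \<alpha>) \<in> R"
    using neg assms H_subset D_subset uminus_in_R
    by (intro diff_in_R) auto
  then have "\<theta> + \<alpha> = \<theta>"
    using highest_rootD[OF assms(1), of "\<theta> + \<alpha>"] simple_nonneg[OF assms(2)] by simp
  then show False
    using assms(2) D_subset zero_notin_R by auto
qed

lemma highest_inner_nonpos:
  assumes "\<theta> \<in> H" "\<theta>' \<in> H" "\<theta> \<noteq> \<theta>'"
  shows "\<theta> \<bullet> \<theta>' \<le> 0"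
proof (rule ccontr)
  assume "\<not> \<theta> \<bullet> \<theta>' \<le> 0"
  then have "\<theta> - \<theta>' \<in> R"
    using assms H_subset by (intro diff_in_R) auto
  then have "\<theta> - \<theta>' \<in> nonneg_combinations D \<or> \<theta>' - \<theta> \<in> nonneg_combinations D"
    using root_sign by fastforce
  then show False
    using highest_rootD assms H_subset by blast
qed

text \<open>The support of a highest root is closed under neighbours in the Dynkin diagram. For
  \<beta> outside it every term of the expansion of \<theta> \<bullet> \<beta> is at most 0, while
  dominance makes the sum nonnegative, so each term vanishes.\<close>

lemma highest_support_closed:
  assumes "\<theta> \<in> H" "\<alpha> \<in> D" "\<beta> \<in> D" "coord \<alpha> \<theta> \<noteq> 0" "coord \<beta> \<theta> = 0"
  shows "\<alpha> \<bullet> \<beta> = 0"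
proof -
  have nonneg: "\<forall>\<delta>\<in>D. 0 \<le> coord \<delta> \<theta>"
    using highest_nonneg[OF assms(1)] nonneg_combinations_iff by auto
  have le: "coord \<delta> \<theta> * (\<delta> \<bullet> \<beta>) \<le> 0" if "\<delta> \<in> D" for \<delta>
    using that nonneg simple_inner_nonpos[OF that assms(3)] assms(5)
    by (cases "\<delta> = \<beta>") (auto simp: mult_nonneg_nonpos)
  have "0 \<le> (\<Sum>\<delta>\<in>D. coord \<delta> \<theta> * (\<delta> \<bullet> \<beta>))"
    using highest_dominant[OF assms(1,3)] inner_root_expansion assms(1) H_subset by (metis subsetD)
  then have "(\<Sum>\<delta>\<in>D. - (coord \<delta> \<theta> * (\<delta> \<bullet> \<beta>))) = 0"
    using sum_nonpos[of D "\<lambda>\<delta>. coord \<delta> \<theta> * (\<delta> \<bullet> \<beta>)"] le by (simp add: sum_negf)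
  then have "\<forall>\<delta>\<in>D. - (coord \<delta> \<theta> * (\<delta> \<bullet> \<beta>)) = 0"
    using sum_nonneg_eq_0_iff[OF finite_D, of "\<lambda>\<delta>. - (coord \<delta> \<theta> * (\<delta> \<bullet> \<beta>))"] le by simp
  then show ?thesis
    using assms(2,4) by auto
qed

text \<open>Dominance and \<open>highest_inner_nonpos\<close> force \<theta> \<bullet> \<theta>' to
  vanish term by term, so every simple root in the support of \<theta> is orthogonal to \<theta>'.
  This is the form in which the splitting of \<open>R\<close> into components enters.\<close>

lemma highest_supports_orthogonal:
  assumes "\<theta> \<in> H" "\<theta>' \<in> H" "\<theta> \<noteq> \<theta>'" "\<alpha> \<in> D" "\<beta> \<in> D" "coord \<alpha> \<theta> \<noteq> 0" "coord \<beta> \<theta>' \<noteq> 0"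
  shows "\<alpha> \<bullet> \<beta> = 0"
proof -
  have nonneg: "\<forall>\<delta>\<in>D. 0 \<le> coord \<delta> \<theta>"
    using highest_nonneg[OF assms(1)] nonneg_combinations_iff by auto
  have ge: "0 \<le> coord \<delta> \<theta> * (\<delta> \<bullet> \<theta>')" if "\<delta> \<in> D" for \<delta>
    using nonneg that highest_dominant[OF assms(2) that] by (simp add: inner_commute)
  have "(\<Sum>\<delta>\<in>D. coord \<delta> \<theta> * (\<delta> \<bullet> \<theta>')) \<le> 0"
    using highest_inner_nonpos[OF assms(1-3)] inner_root_expansion assms(1) H_subset by (metis subsetD)
  then have "(\<Sum>\<delta>\<in>D. coord \<delta> \<theta> * (\<delta> \<bullet> \<theta>')) = 0"
    using ge by (meson antisym sum_nonneg)
  then have zero: "coord \<delta> \<theta> * (\<delta> \<bullet> \<theta>') = 0" if "\<delta> \<in> D" for \<delta>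
    using sum_nonneg_eq_0_iff[OF finite_D, of "\<lambda>\<delta>. coord \<delta> \<theta> * (\<delta> \<bullet> \<theta>')"] ge that by simp
  let ?I = "{\<delta>\<in>D. coord \<delta> \<theta> \<noteq> 0}"
  \<comment> \<open>\<open>y\<close> is the part of \<theta>' carried by the support of \<theta>. It
    is orthogonal to the remaining part and to \<theta>', hence to itself, so the two supports are
    disjoint.\<close>
  define y where "y = (\<Sum>\<delta>\<in>?I. coord \<delta> \<theta>' *\<^sub>R \<delta>)"
  define z where "z = (\<Sum>\<delta>\<in>D - ?I. coord \<delta> \<theta>' *\<^sub>R \<delta>)"
  have sum: "\<theta>' = y + z"
    unfolding y_def z_def
    using coord_expansion[of \<theta>'] assms(2) H_subset
      sum.subset_diff[of ?I D "\<lambda>\<delta>. coord \<delta> \<theta>' *\<^sub>R \<delta>"] finite_D by (auto simp: add.commute)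
  have "y \<bullet> z = 0"
    unfolding y_def z_def inner_sum_left inner_sum_right
    using highest_support_closed[OF assms(1)] by (intro sum.neutral ballI) auto
  moreover have "y \<bullet> \<theta>' = 0"
    unfolding y_def inner_sum_left using zero by (intro sum.neutral ballI) auto
  ultimately have "y = 0"
    unfolding sum by (simp add: inner_add_right)
  have "coord \<alpha> y = coord \<alpha> \<theta>'"
  proof -
    have "y = (\<Sum>\<delta>\<in>D. (if coord \<delta> \<theta> \<noteq> 0 then coord \<delta> \<theta>' else 0) *\<^sub>R \<delta>)"
      unfolding y_def by (intro sum.mono_neutral_cong_left) (auto simp: finite_D)
    then have "coord \<alpha> y = (if coord \<alpha> \<theta> \<noteq> 0 then coord \<alpha> \<theta>' else 0)"
      using coord_sum[OF assms(4), of "\<lambda>\<delta>. if coord \<delta> \<theta> \<noteq> 0 then coord \<delta> \<theta>' else 0"] by (simp only:)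
    then show ?thesis
      using assms(6) by simp
  qed
  then have "coord \<alpha> \<theta>' = 0"
    using \<open>y = 0\<close> by (simp add: coord_linear_simps)
  then show ?thesis
    using highest_support_closed[OF assms(2) assms(5) assms(4) assms(7)] by (simp add: inner_commute)
qed

text \<open>Stands for the highest root of the component of \<gamma>. Requiring both conditions
  makes the predicate symmetric in \<gamma> and -\<gamma>, so \<open>SOME\<close> returns the same
  root for both; it also bounds the coordinates of \<gamma> in absolute value.\<close>

definition highest_above :: "'a \<Rightarrow> 'a" where
  "highest_above \<gamma> =
     (SOME \<theta>. \<theta> \<in> H \<and> \<theta> - \<gamma> \<in> nonneg_combinations D \<and> \<theta> + \<gamma> \<in> nonneg_combinations D)"

text \<open>A root of maximal height among those above \<gamma> will do: a root above it has no
  larger height, so their difference, having nonnegative coordinates, vanishes.\<close>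

lemma exists_highest_above:
  assumes "\<gamma> \<in> R"
  shows "\<exists>\<theta>\<in>H. \<theta> - \<gamma> \<in> nonneg_combinations D"
proof -
  define ht where "ht x = (\<Sum>\<delta>\<in>D. coord \<delta> x)" for x
  let ?U = "{\<beta>\<in>R. \<beta> - \<gamma> \<in> nonneg_combinations D}"
  have "\<gamma> \<in> ?U"
    using assms nonneg_combinations_iff[of 0] by (simp add: coord_linear_simps)
  then have "finite (ht ` ?U)" "ht ` ?U \<noteq> {}"
    using finite_R by auto
  then obtain \<theta> where \<theta>: "\<theta> \<in> ?U" "Max (ht ` ?U) = ht \<theta>"
    using Max_in by (metis (no_types, lifting) imageE)
  have max: "ht \<beta> \<le> ht \<theta>" if "\<beta> \<in> ?U" for \<beta>
    using Max_ge[OF \<open>finite (ht ` ?U)\<close> imageI[OF that]] \<theta>(2) by simp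
  have "\<beta> = \<theta>" if \<beta>: "\<beta> \<in> R" "\<beta> - \<theta> \<in> nonneg_combinations D" for \<beta>
  proof -
    have "\<beta> - \<gamma> \<in> nonneg_combinations D"
      using nonneg_combinations_add[OF \<beta>(2), of "\<theta> - \<gamma>"] \<theta>(1) by simp
    then have "ht \<beta> \<le> ht \<theta>"
      using max \<beta>(1) by simp
    then have "(\<Sum>\<delta>\<in>D. coord \<delta> (\<beta> - \<theta>)) \<le> 0"
      by (simp add: ht_def coord_linear_simps sum_subtractf)
    moreover have nn: "\<forall>\<delta>\<in>D. 0 \<le> coord \<delta> (\<beta> - \<theta>)" "(\<Sum>\<delta>\<in>D. coord \<delta> (\<beta> - \<theta>) *\<^sub>R \<delta>) = \<beta> - \<theta>"
      using \<beta>(2) nonneg_combinations_iff by auto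
    ultimately have "\<forall>\<delta>\<in>D. coord \<delta> (\<beta> - \<theta>) = 0"
      using finite_D by (metis (mono_tags, lifting) antisym sum_nonneg sum_nonneg_eq_0_iff)
    then have "(\<Sum>\<delta>\<in>D. coord \<delta> (\<beta> - \<theta>) *\<^sub>R \<delta>) = 0"
      by simp
    then have "\<beta> - \<theta> = 0"
      using nn(2) by metis
    then show ?thesis
      by simp
  qed
  then have "\<theta> \<in> H"
    using \<theta>(1) by (simp add: highest_roots_def)
  then show ?thesis
    using \<theta>(1) by blast
qed

lemma highest_above:
  assumes "\<gamma> \<in> R"
  shows "highest_above \<gamma> \<in> H" "highest_above \<gamma> - \<gamma> \<in> nonneg_combinations D"
    "highest_above \<gamma> + \<gamma> \<in> nonneg_combinations D"
proof -
  have "\<exists>\<theta>. \<theta> \<in> H \<and> \<theta> - \<gamma> \<in> nonneg_combinations D \<and> \<theta> + \<gamma> \<in> nonneg_combinations D"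
  proof (cases "\<gamma> \<in> nonneg_combinations D")
    case True
    then show ?thesis
      using exists_highest_above[OF assms] highest_nonneg nonneg_combinations_add by blast
  next
    case False
    then have "- \<gamma> \<in> nonneg_combinations D"
      using root_sign assms by blast
    then show ?thesis
      using exists_highest_above[OF uminus_in_R[OF assms]] highest_nonneg nonneg_combinations_add
      by fastforce
  qed
  then have "highest_above \<gamma> \<in> H \<and> highest_above \<gamma> - \<gamma> \<in> nonneg_combinations D
      \<and> highest_above \<gamma> + \<gamma> \<in> nonneg_combinations D"
    unfolding highest_above_def by (rule someI_ex)
  then show "highest_above \<gamma> \<in> H" "highest_above \<gamma> - \<gamma> \<in> nonneg_combinations D"
    "highest_above \<gamma> + \<gamma> \<in> nonneg_combinations D"
    by auto
qed

lemma abs_coord_le_highest: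
  assumes "\<gamma> \<in> R" "\<alpha> \<in> D"
  shows "\<bar>coord \<alpha> \<gamma>\<bar> \<le> coord \<alpha> (highest_above \<gamma>)"
  using highest_above(2,3)[OF assms(1)] assms(2) unfolding nonneg_combinations_iff
  by (force simp: coord_linear_simps)

lemma highest_above_uminus: "highest_above (- \<gamma>) = highest_above \<gamma>"
  unfolding highest_above_def by (rule arg_cong[of _ _ Eps]) auto

lemma highest_above_highest: "\<theta> \<in> H \<Longrightarrow> highest_above \<theta> = \<theta>"
  using highest_above[of \<theta>] highest_rootD H_subset by blast

text \<open>By \<open>abs_coord_le_highest\<close> the support of a root lies in that of its highest
  root, and distinct highest roots have orthogonal supports. Non-orthogonal roots thus belong to one
  component.\<close>

lemma highest_above_eq:
  assumes "\<gamma> \<in> R" "\<gamma>' \<in> R" "\<gamma> \<bullet> \<gamma>' \<noteq> 0"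
  shows "highest_above \<gamma> = highest_above \<gamma>'"
proof (rule ccontr)
  assume ne: "highest_above \<gamma> \<noteq> highest_above \<gamma>'"
  have "coord \<alpha> \<gamma> * (\<alpha> \<bullet> (coord \<beta> \<gamma>' *\<^sub>R \<beta>)) = 0" if "\<alpha> \<in> D" "\<beta> \<in> D" for \<alpha> \<beta>
    using highest_supports_orthogonal[OF highest_above(1)[OF assms(1)] highest_above(1)[OF assms(2)] ne that]
      abs_coord_le_highest[OF assms(1) that(1)] abs_coord_le_highest[OF assms(2) that(2)]
    by force
  then have "(\<Sum>\<alpha>\<in>D. coord \<alpha> \<gamma> * (\<alpha> \<bullet> (\<Sum>\<beta>\<in>D. coord \<beta> \<gamma>' *\<^sub>R \<beta>))) = 0"
    by (intro sum.neutral ballI) (auto simp: inner_sum_right sum_distrib_left intro!: sum.neutral)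
  then show False
    using assms inner_root_expansion coord_expansion by metis
qed

lemma highest_above_reflection:
  assumes "\<gamma> \<in> R" "\<alpha> \<in> R"
  shows "highest_above (\<gamma> - (2 * (\<gamma> \<bullet> \<alpha>) / (\<alpha> \<bullet> \<alpha>)) *\<^sub>R \<alpha>) = highest_above \<gamma>"
proof (cases "\<gamma> \<bullet> \<alpha> = 0")
  case False
  let ?\<gamma>' = "\<gamma> - (2 * (\<gamma> \<bullet> \<alpha>) / (\<alpha> \<bullet> \<alpha>)) *\<^sub>R \<alpha>"
  have "?\<gamma>' \<bullet> \<alpha> = - (\<gamma> \<bullet> \<alpha>)"
    using inner_self_pos[OF assms(2)] by (simp add: inner_diff_left)
  then show ?thesis
    using highest_above_eq[OF reflection_in_R[OF assms(2,1)] assms(2)] highest_above_eq[OF assms False]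
      False by simp
qed simp

end

section \<open>Affine roots\<close>

text \<open>The pair \<open>(\<gamma>, k)\<close> stands for the affine function \<open>x \<mapsto> \<gamma> \<bullet> x + k\<close>.\<close>

definition affine_eval :: "'a::euclidean_space \<times> real \<Rightarrow> 'a \<Rightarrow> real" where
  "affine_eval f x = fst f \<bullet> x + snd f"

text \<open>The Cartan number of the linear parts. Constant parts do not enter, so the form behind
  it is degenerate on affine functions, with the constants as radical.\<close>

definition pairing :: "'a::euclidean_space \<times> real \<Rightarrow> 'a \<times> real \<Rightarrow> real" where
  "pairing f a = 2 * (fst f \<bullet> fst a) / (fst a \<bullet> fst a)"

definition reflect :: "'a::euclidean_space \<times> real \<Rightarrow> 'a \<times> real \<Rightarrow> 'a \<times> real" where
  "reflect a f = f - pairing f a *\<^sub>R a"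

definition wall_reflection :: "'a::euclidean_space \<times> real \<Rightarrow> 'a \<Rightarrow> 'a" where
  "wall_reflection a = affine_reflection (fst a) (- snd a)"

lemma fst_reflect: "fst (reflect a f) = fst f - pairing f a *\<^sub>R fst a"
  and snd_reflect: "snd (reflect a f) = snd f - pairing f a * snd a"
  by (simp_all add: reflect_def)

lemma affine_eval_reflect: "affine_eval (reflect a f) x = affine_eval f (wall_reflection a x)"
  by (simp add: affine_eval_def fst_reflect snd_reflect pairing_def wall_reflection_def
      affine_reflection_def inner_diff_left inner_diff_right inner_commute algebra_simps
      add_divide_distrib)

lemma wall_reflection_wall_reflection:
  "fst a \<noteq> 0 \<Longrightarrow> wall_reflection a (wall_reflection a x) = x"
  by (simp add: wall_reflection_def affine_reflection_def inner_diff_left field_simps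
      flip: scaleR_left_distrib)

lemma wall_reflection_uminus: "wall_reflection (- a) = wall_reflection a"
  by (rule ext) (simp add: wall_reflection_def affine_reflection_def add_divide_distrib
      diff_divide_distrib algebra_simps)

lemma affine_eval_inject: "(\<forall>x. affine_eval f x = affine_eval g x) \<longleftrightarrow> f = g"
proof
  assume eq: "\<forall>x. affine_eval f x = affine_eval g x"
  then have "snd f = snd g"
    by (auto simp: affine_eval_def dest: spec[of _ 0])
  moreover have "fst f \<bullet> x = fst g \<bullet> x" for x
    using eq \<open>snd f = snd g\<close> by (auto simp: affine_eval_def)
  then have "fst f = fst g"
    using vector_eq_rdot by blast
  ultimately show "f = g"
    by (simp add: prod_eq_iff)
qed simp

text \<open>A reflection displaces a point along the normal by a multiple of the function value. The
  value is transported by \<open>affine_eval_reflect\<close>, the normal by the linear part of the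
  reflection in \<open>a\<close> (\<open>lin\<close>), and its length does not change
  (\<open>norm\<close>).\<close>

lemma wall_reflection_reflect:
  assumes "fst a \<noteq> 0"
  shows "wall_reflection (reflect a f) x = wall_reflection a (wall_reflection f (wall_reflection a x))"
proof -
  define y where "y = wall_reflection a x"
  have x: "x = wall_reflection a y"
    unfolding y_def by (simp add: wall_reflection_wall_reflection assms)
  have ref: "wall_reflection g z = z - (2 * affine_eval g z / (fst g \<bullet> fst g)) *\<^sub>R fst g" for g :: "'a \<times> real" and z
    by (simp add: wall_reflection_def affine_reflection_def affine_eval_def inner_commute)
  have norm: "fst (reflect a f) \<bullet> fst (reflect a f) = fst f \<bullet> fst f"
    using assms by (simp add: fst_reflect pairing_def inner_diff_left inner_diff_right
        inner_commute field_simps)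
  have lin: "wall_reflection a (z - c *\<^sub>R v) = wall_reflection a z - c *\<^sub>R (v - pairing (v, 0) a *\<^sub>R fst a)"
    for z v c
    unfolding ref affine_eval_def pairing_def
    by (simp add: inner_diff_right inner_commute algebra_simps diff_divide_distrib)
  have "wall_reflection (reflect a f) x = x - (2 * affine_eval f y / (fst f \<bullet> fst f)) *\<^sub>R fst (reflect a f)"
    unfolding ref[of "reflect a f"] affine_eval_reflect norm y_def by simp
  also have "\<dots> = wall_reflection a (y - (2 * affine_eval f y / (fst f \<bullet> fst f)) *\<^sub>R fst f)"
    unfolding lin x[symmetric] by (simp add: fst_reflect pairing_def)
  also have "\<dots> = wall_reflection a (wall_reflection f y)"
    by (simp add: ref[of f])
  finally show ?thesis
    by (simp add: y_def)
qed

section \<open>Affine roots, their coordinates and their signs\<close>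

context based_root_system
begin

definition affine_roots :: "('a \<times> real) set" where
  "affine_roots = R \<times> \<int>"

text \<open>The wall where \<theta> takes the value 1 is encoded as 1 - \<theta>, not \<theta> - 1,
  so that all walls are nonnegative on the fundamental alcove.\<close>

definition simple_affine_roots :: "('a \<times> real) set" where
  "simple_affine_roots = (\<lambda>\<alpha>. (\<alpha>, 0)) ` D \<union> (\<lambda>\<theta>. (- \<theta>, 1)) ` H"

lemma affine_generators_eq: "affine_generators R D = wall_reflection ` simple_affine_roots"
proof -
  have "affine_reflection (- \<theta>) (-1) = affine_reflection \<theta> 1" for \<theta> :: 'a
    using wall_reflection_uminus[of "(\<theta>, -1)"] by (simp add: wall_reflection_def)
  then show ?thesis
    by (simp add: affine_generators_def simple_affine_roots_def image_Un image_image wall_reflection_def)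
qed

lemma simple_affine_roots_subset: "simple_affine_roots \<subseteq> affine_roots"
  using D_subset H_subset uminus_in_R by (auto simp: simple_affine_roots_def affine_roots_def)

lemma simple_affine_root: "a \<in> simple_affine_roots \<Longrightarrow> a \<in> affine_roots"
  using simple_affine_roots_subset by blast

lemma finite_simple_affine_roots: "finite simple_affine_roots"
  using finite_D finite_subset[OF H_subset finite_R] by (simp add: simple_affine_roots_def)

lemma fst_affine_root: "f \<in> affine_roots \<Longrightarrow> fst f \<in> R"
  by (auto simp: affine_roots_def)

lemma fst_affine_root_pos: "f \<in> affine_roots \<Longrightarrow> 0 < fst f \<bullet> fst f"
  using fst_affine_root inner_self_pos by blast

lemma fst_affine_root_nonzero: "f \<in> affine_roots \<Longrightarrow> fst f \<noteq> 0"
  using fst_affine_root zero_notin_R by metis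

lemma uminus_affine_root: "f \<in> affine_roots \<Longrightarrow> - f \<in> affine_roots"
  using uminus_in_R by (auto simp: affine_roots_def)

lemma reflect_affine_root:
  assumes "a \<in> affine_roots" "f \<in> affine_roots"
  shows "reflect a f \<in> affine_roots"
proof -
  have "pairing f a \<in> \<int>"
    using cartan_integer assms fst_affine_root unfolding pairing_def by blast
  moreover have "fst (reflect a f) \<in> R"
    using reflection_in_R assms fst_affine_root unfolding fst_reflect pairing_def by blast
  ultimately show ?thesis
    using assms by (auto simp: affine_roots_def mem_Times_iff snd_reflect)
qed

lemma reflect_reflect: "a \<in> affine_roots \<Longrightarrow> reflect a (reflect a f) = f"
  using fst_affine_root_pos[of a]
  by (simp add: reflect_def pairing_def inner_diff_left field_simps flip: scaleR_left_distrib)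

lemma reflect_self: "a \<in> affine_roots \<Longrightarrow> reflect a a = - a"
  using fst_affine_root_pos[of a] by (simp add: reflect_def pairing_def scaleR_2)

lemma norm_reflect:
  assumes "a \<in> affine_roots"
  shows "norm (fst (reflect a f)) = norm (fst f)"
  unfolding norm_eq using fst_affine_root_pos[OF assms]
  by (simp add: fst_reflect pairing_def inner_diff_left inner_diff_right inner_commute field_simps)

text \<open>For reducible \<open>R\<close> the simple affine roots are linearly dependent. The coefficients below are
  those of the unique expansion of \<open>(\<gamma>, k)\<close> in which, besides simple roots, only the highest
  root of the component of \<open>\<gamma>\<close> is used.\<close>

definition affine_coord :: "'a \<times> real \<Rightarrow> 'a \<times> real \<Rightarrow> real" where
  "affine_coord f b =
     (if snd b = 0 then coord (fst b) (fst f) + snd f * coord (fst b) (highest_above (fst f))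
      else if fst b = - highest_above (fst f) then snd f else 0)"

lemma affine_coord_simple:
  assumes "a \<in> simple_affine_roots" "b \<in> simple_affine_roots"
  shows "affine_coord a b = (if b = a then 1 else 0)"
  using assms
  by (auto simp: simple_affine_roots_def affine_coord_def coord_simple highest_above_uminus
      highest_above_highest coord_linear_simps split: if_splits)

lemma affine_coord_uminus:
  "affine_coord (- f) b = - affine_coord f b"
  by (simp add: affine_coord_def highest_above_uminus coord_linear_simps)

text \<open>As for a basis, only the coordinate at \<open>a\<close> moves, although
  \<open>affine_coord\<close> is linear only within one component: if the pairing is nonzero,
  \<open>f\<close>, \<open>a\<close> and the reflected function are all expanded with the same
  highest root.\<close>

lemma affine_coord_reflect:
  assumes "a \<in> simple_affine_roots" "f \<in> affine_roots" "b \<in> simple_affine_roots"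
  shows "affine_coord (reflect a f) b = affine_coord f b - (if b = a then pairing f a else 0)"
proof -
  have a: "a \<in> affine_roots"
    using assms(1) simple_affine_roots_subset by blast
  have h: "highest_above (fst (reflect a f)) = highest_above (fst f)"
    unfolding fst_reflect pairing_def
    using highest_above_reflection fst_affine_root assms(2) a by blast
  show ?thesis
  proof (cases "pairing f a = 0")
    case True
    then show ?thesis by (simp add: reflect_def)
  next
    case False
    then have hfa: "highest_above (fst f) = highest_above (fst a)"
      using highest_above_eq[of "fst f" "fst a"] fst_affine_root assms(2) a by (auto simp: pairing_def)
    show ?thesis
    proof (cases "snd a = 0")
      case True
      then have aD: "fst a \<in> D" "a = (fst a, 0)"
        using assms(1) by (auto simp: simple_affine_roots_def)
      show ?thesis
      proof (cases "snd b = 0")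
        case b: True
        then have "fst b \<in> D" "b = (fst b, 0)"
          using assms(3) by (auto simp: simple_affine_roots_def)
        then show ?thesis
          unfolding affine_coord_def h
          using aD by (auto simp: snd_reflect fst_reflect coord_linear_simps coord_simple prod_eq_iff)
      next
        case False
        then show ?thesis
          using True by (auto simp: affine_coord_def h snd_reflect)
      qed
    next
      case snda: False
      then obtain \<theta> where \<theta>: "\<theta> \<in> H" "a = (- \<theta>, 1)"
        using assms(1) by (auto simp: simple_affine_roots_def)
      then have hf: "highest_above (fst f) = \<theta>"
        using hfa highest_above_uminus highest_above_highest by simp
      show ?thesis
      proof (cases "snd b = 0")
        case True
        then show ?thesis
          unfolding affine_coord_def h hf
          using \<theta> by (auto simp: snd_reflect fst_reflect coord_linear_simps algebra_simps)
      next
        case False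
        then have "snd b = 1"
          using assms(3) by (auto simp: simple_affine_roots_def)
        then show ?thesis
          using \<theta> by (auto simp: affine_coord_def h hf snd_reflect prod_eq_iff)
      qed
    qed
  qed
qed

lemma sum_simple_affine_roots:
  fixes g :: "'a \<times> real \<Rightarrow> 'b::comm_monoid_add"
  shows "(\<Sum>b\<in>simple_affine_roots. g b) = (\<Sum>\<alpha>\<in>D. g (\<alpha>, 0)) + (\<Sum>\<theta>\<in>H. g (- \<theta>, 1))"
proof -
  let ?A = "(\<lambda>\<alpha>. (\<alpha>, 0::real)) ` D" and ?B = "(\<lambda>\<theta>. (- \<theta>, 1::real)) ` H"
  have "finite ?A" "finite ?B"
    by (rule finite_imageI[OF finite_D], rule finite_imageI[OF finite_subset[OF H_subset finite_R]])
  moreover have "?A \<inter> ?B = {}"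
    unfolding disjoint_iff by auto
  ultimately have "sum g (?A \<union> ?B) = sum g ?A + sum g ?B"
    by (rule sum.union_disjoint)
  moreover have "inj_on (\<lambda>\<alpha>. (\<alpha>, 0::real)) D" "inj_on (\<lambda>\<theta>. (- \<theta>, 1::real)) H"
    by (simp_all add: inj_on_def)
  ultimately show ?thesis
    unfolding simple_affine_roots_def by (simp only: sum.reindex o_def)
qed

text \<open>With \<theta> the highest root of the component of \<gamma>, the expansion is \<gamma> +
  k = (\<gamma> + k \<theta>) + k (1 - \<theta>).\<close>

lemma affine_coord_expansion:
  assumes "f \<in> affine_roots"
  shows "(\<Sum>b\<in>simple_affine_roots. affine_coord f b *\<^sub>R b) = f"
proof -
  let ?h = "highest_above (fst f)"
  have finH: "finite H"
    using finite_subset[OF H_subset finite_R] .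
  have hH: "?h \<in> H"
    using highest_above(1) fst_affine_root assms by blast
  have 1: "(\<Sum>\<alpha>\<in>D. affine_coord f (\<alpha>, 0) *\<^sub>R (\<alpha>, 0::real)) = (fst f + snd f *\<^sub>R ?h, 0)"
  proof -
    have "(\<Sum>\<alpha>\<in>D. affine_coord f (\<alpha>, 0) *\<^sub>R \<alpha>) =
        (\<Sum>\<alpha>\<in>D. coord \<alpha> (fst f) *\<^sub>R \<alpha>) + snd f *\<^sub>R (\<Sum>\<alpha>\<in>D. coord \<alpha> ?h *\<^sub>R \<alpha>)"
      by (simp add: affine_coord_def scaleR_left_distrib sum.distrib scaleR_sum_right)
    also have "\<dots> = fst f + snd f *\<^sub>R ?h"
      using coord_expansion fst_affine_root[OF assms] hH H_subset by (auto simp: subset_iff)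
    finally show ?thesis
      by (simp add: prod_eq_iff fst_sum snd_sum)
  qed
  have "(\<Sum>\<theta>\<in>H. affine_coord f (- \<theta>, 1) *\<^sub>R (- \<theta>, 1::real)) =
      (\<Sum>\<theta>\<in>H. if \<theta> = ?h then snd f *\<^sub>R (- ?h, 1) else 0)"
    by (intro sum.cong) (auto simp: affine_coord_def zero_prod_def)
  also have "\<dots> = snd f *\<^sub>R (- ?h, 1)"
    using finH hH by simp
  finally show ?thesis
    unfolding sum_simple_affine_roots 1 by (simp add: prod_eq_iff)
qed

definition positive_affine_roots :: "('a \<times> real) set" where
  "positive_affine_roots = {f \<in> affine_roots. \<forall>b\<in>simple_affine_roots. 0 \<le> affine_coord f b}"

lemma positive_affine_roots_subset: "positive_affine_roots \<subseteq> affine_roots"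
  by (auto simp: positive_affine_roots_def)

text \<open>For k \<ge> 1 the coordinates of \<gamma> + k \<theta> are nonnegative, because those of
  \<gamma> are bounded in absolute value by those of \<theta>. For k = 0 the sign is that of the
  finite root, and k \<le> -1 follows by negation.\<close>

lemma affine_root_sign:
  assumes "f \<in> affine_roots"
  shows "f \<in> positive_affine_roots \<or> - f \<in> positive_affine_roots"
proof -
  have pos: "g \<in> positive_affine_roots" if g: "g \<in> affine_roots" "1 \<le> snd g" for g
  proof -
    have "0 \<le> affine_coord g b" if "b \<in> simple_affine_roots" for b
    proof (cases "snd b = 0")
      case True
      then have b: "fst b \<in> D"
        using that by (auto simp: simple_affine_roots_def)
      have "\<bar>coord (fst b) (fst g)\<bar> \<le> coord (fst b) (highest_above (fst g))"
        using abs_coord_le_highest fst_affine_root g(1) b by blast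
      moreover have "coord (fst b) (highest_above (fst g)) \<le> snd g * coord (fst b) (highest_above (fst g))"
        using calculation mult_right_mono[OF g(2), of "coord (fst b) (highest_above (fst g))"] by simp
      ultimately show ?thesis
        using True by (simp add: affine_coord_def)
    next
      case False
      then show ?thesis
        using g(2) by (simp add: affine_coord_def)
    qed
    then show ?thesis
      using g(1) by (simp add: positive_affine_roots_def)
  qed
  have zero: "g \<in> positive_affine_roots"
    if "g \<in> affine_roots" "snd g = 0" "fst g \<in> nonneg_combinations D" for g
    using that unfolding positive_affine_roots_def simple_affine_roots_def nonneg_combinations_iff
    by (auto simp: affine_coord_def)
  obtain k :: int where k: "snd f = of_int k"
    using assms by (auto simp: affine_roots_def elim: Ints_cases)
  consider "1 \<le> k" | "k \<le> -1" | "k = 0"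
    by linarith
  then show ?thesis
  proof cases
    case 1
    then show ?thesis
      using pos[OF assms] k by simp
  next
    case 2
    then have "1 \<le> snd (- f)"
      using k by simp
    then show ?thesis
      using pos[OF uminus_affine_root[OF assms]] by simp
  next
    case 3
    then show ?thesis
      using zero[OF assms] zero[OF uminus_affine_root[OF assms]] root_sign[OF fst_affine_root[OF assms]] k
      by auto
  qed
qed

lemma affine_coords_eq_0:
  assumes "f \<in> affine_roots" shows "\<not> (\<forall>b\<in>simple_affine_roots. affine_coord f b = 0)"
proof
  assume "\<forall>b\<in>simple_affine_roots. affine_coord f b = 0"
  then have "(\<Sum>b\<in>simple_affine_roots. affine_coord f b *\<^sub>R b) = 0"
    by simp
  then show False
    using affine_coord_expansion[OF assms] fst_affine_root_nonzero[OF assms] by simp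
qed

lemma positive_affine_roots_antisym:
  "f \<in> positive_affine_roots \<Longrightarrow> - f \<notin> positive_affine_roots"
  using affine_coords_eq_0[of f] by (force simp: positive_affine_roots_def affine_coord_uminus)

section \<open>The closed alcove and the orbits of the simple affine roots\<close>

definition alcove :: "'a set" where
  "alcove = {x. \<forall>a\<in>simple_affine_roots. 0 \<le> affine_eval a x}"

lemma zero_in_alcove: "0 \<in> alcove"
  by (auto simp: alcove_def simple_affine_roots_def affine_eval_def)

lemma affine_eval_sum:
  assumes "f \<in> affine_roots"
  shows "affine_eval f x = (\<Sum>b\<in>simple_affine_roots. affine_coord f b * affine_eval b x)"
  by (subst affine_coord_expansion[OF assms, symmetric])
    (simp add: affine_eval_def fst_sum snd_sum inner_sum_left sum.distrib distrib_left)

lemma positive_on_alcove: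
  "f \<in> positive_affine_roots \<Longrightarrow> x \<in> alcove \<Longrightarrow> 0 \<le> affine_eval f x"
  by (subst affine_eval_sum) (auto simp: positive_affine_roots_def alcove_def intro!: sum_nonneg)

text \<open>The constant part is the value at 0, a point of the alcove. This turns signs of affine
  roots into bounds on integers.\<close>

lemma snd_positive_nonneg: "f \<in> positive_affine_roots \<Longrightarrow> 0 \<le> snd f"
  using positive_on_alcove[OF _ zero_in_alcove] by (simp add: affine_eval_def)

lemma proportional_affine_roots:
  assumes "f \<in> affine_roots" "a \<in> affine_roots" "f = c *\<^sub>R a"
  shows "f = a \<or> f = - a"
proof -
  have "c = 1 \<or> c = -1"
    using proportional_roots[of "fst a" c] fst_affine_root[OF assms(1)] fst_affine_root[OF assms(2)]
      assms(3) by simp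
  then show ?thesis
    using assms(3) by auto
qed

lemma simple_affine_root_positive: "a \<in> simple_affine_roots \<Longrightarrow> a \<in> positive_affine_roots"
  using simple_affine_roots_subset by (auto simp: positive_affine_roots_def affine_coord_simple)

text \<open>Reflection changes only the coordinate at \<open>a\<close>. If the result were negative,
  all other coordinates of \<open>f\<close> would vanish, leaving a multiple of
  \<open>a\<close>.\<close>

lemma reflect_positive:
  assumes "a \<in> simple_affine_roots" "f \<in> positive_affine_roots" "f \<noteq> a"
  shows "reflect a f \<in> positive_affine_roots"
proof (rule ccontr)
  have aff: "a \<in> affine_roots" "f \<in> affine_roots"
    using assms simple_affine_roots_subset positive_affine_roots_subset by auto
  assume "reflect a f \<notin> positive_affine_roots"
  then have "- reflect a f \<in> positive_affine_roots"
    using affine_root_sign reflect_affine_root aff by blast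
  have "affine_coord f b = 0" if "b \<in> simple_affine_roots - {a}" for b
  proof -
    have "0 \<le> - affine_coord (reflect a f) b" "0 \<le> affine_coord f b"
      using assms(2) \<open>- reflect a f \<in> positive_affine_roots\<close> that
      unfolding positive_affine_roots_def affine_coord_uminus[symmetric] by blast+
    then show ?thesis
      using affine_coord_reflect[OF assms(1) aff(2), of b] that by simp
  qed
  then have "(\<Sum>b\<in>simple_affine_roots - {a}. affine_coord f b *\<^sub>R b) = 0"
    by (intro sum.neutral) simp
  then have "f = affine_coord f a *\<^sub>R a"
    using affine_coord_expansion[OF aff(2)] sum.remove[OF finite_simple_affine_roots assms(1), of "\<lambda>b. affine_coord f b *\<^sub>R b"]
    by simp
  then have "f = - a"
    using proportional_affine_roots[OF aff(2,1)] assms(3) by blast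
  then show False
    using assms(2) simple_affine_root_positive[OF assms(1)] positive_affine_roots_antisym by blast
qed

text \<open>The constant part of such a root \<gamma> + k is an integer between 0 and the absolute
  value of \<gamma> \<bullet> p.\<close>

lemma finite_negative_at: "finite {f \<in> positive_affine_roots. affine_eval f p < 0}"
proof -
  define M where "M = (\<Sum>\<gamma>\<in>R. \<bar>\<gamma> \<bullet> p\<bar>)"
  have "{f \<in> positive_affine_roots. affine_eval f p < 0} \<subseteq> R \<times> (of_int ` {0..\<lceil>M\<rceil>})"
  proof
    fix f assume "f \<in> {f \<in> positive_affine_roots. affine_eval f p < 0}"
    then have f: "f \<in> positive_affine_roots" "affine_eval f p < 0"
      by auto
    then have fR: "fst f \<in> R" and "snd f \<in> \<int>"
      using positive_affine_roots_subset by (auto simp: affine_roots_def)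
    then obtain k :: int where k: "snd f = of_int k"
      by (auto elim: Ints_cases)
    have "\<bar>fst f \<bullet> p\<bar> \<le> M"
      unfolding M_def using fR finite_R by (intro member_le_sum) auto
    then have "of_int k \<le> M"
      using f(2) k by (simp add: affine_eval_def)
    then have "k \<in> {0..\<lceil>M\<rceil>}"
      using snd_positive_nonneg[OF f(1)] k le_of_int_ceiling[of M] by simp linarith
    then show "f \<in> R \<times> (of_int ` {0..\<lceil>M\<rceil>})"
      using fR k by (auto simp: mem_Times_iff)
  qed
  then show ?thesis
    using finite_R finite_subset by blast
qed

text \<open>Reflecting the point in a simple wall \<open>a\<close> on whose negative side it lies
  lowers the number of positive roots that are negative there: \<open>reflect a\<close> embeds the
  new set into the old one without \<open>a\<close>.\<close>

lemma move_into_alcove: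
  "\<exists>as. set as \<subseteq> simple_affine_roots \<and> foldr wall_reflection as p \<in> alcove"
proof (induction "card {f \<in> positive_affine_roots. affine_eval f p < 0}" arbitrary: p rule: less_induct)
  case less
  let ?N = "\<lambda>p. {f \<in> positive_affine_roots. affine_eval f p < 0}"
  show ?case
  proof (cases "p \<in> alcove")
    case True
    then show ?thesis
      by (intro exI[of _ "[]"]) simp
  next
    case False
    then obtain a where a: "a \<in> simple_affine_roots" "affine_eval a p < 0"
      by (auto simp: alcove_def not_le)
    let ?q = "wall_reflection a p"
    have aff: "a \<in> affine_roots"
      using a simple_affine_roots_subset by blast
    have inN: "a \<in> ?N p"
      using a simple_affine_root_positive by simp
    have "reflect a ` ?N ?q \<subseteq> ?N p - {a}"
    proof (intro image_subsetI)
      fix f assume f: "f \<in> ?N ?q"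
      have "f \<noteq> a"
        using f a(2) reflect_self[OF aff] affine_eval_reflect[of a a p]
        by (auto simp: affine_eval_def)
      moreover have "reflect a f \<noteq> a"
      proof
        assume "reflect a f = a"
        then have "f = - a"
          using reflect_reflect[OF aff, of f] reflect_self[OF aff] by simp
        then show False
          using f simple_affine_root_positive[OF a(1)] positive_affine_roots_antisym by auto
      qed
      ultimately show "reflect a f \<in> ?N p - {a}"
        using f reflect_positive[OF a(1)] by (simp add: affine_eval_reflect)
    qed
    moreover have "inj_on (reflect a) (?N ?q)"
      by (metis inj_onI reflect_reflect[OF aff])
    ultimately have "card (?N ?q) \<le> card (?N p - {a})"
      using finite_negative_at by (intro card_inj_on_le) auto
    also have "\<dots> < card (?N p)"
      using inN finite_negative_at by (intro card_Diff1_less) auto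
    finally obtain as where as: "set as \<subseteq> simple_affine_roots" "foldr wall_reflection as ?q \<in> alcove"
      using less by blast
    then show ?thesis
      \<comment> \<open>\<open>foldr\<close> applies the last letter first, so the reflection
        already performed goes to the end.\<close>
      using a(1) by (intro exI[of _ "as @ [a]"]) simp
  qed
qed

text \<open>\<open>foldr reflect as f\<close> is \<open>f\<close> precomposed with the inverse of
  the motion of points. Evaluation thus determines the new function by the group element alone,
  whatever word represents it.\<close>

lemma affine_eval_foldr:
  assumes "set as \<subseteq> simple_affine_roots"
  shows "affine_eval (foldr reflect as f) (foldr wall_reflection as x) = affine_eval f x"
  using assms
proof (induction as)
  case (Cons a as)
  then have "fst a \<noteq> 0"
    using simple_affine_root fst_affine_root_nonzero by simp
  then show ?case
    using Cons by (simp add: affine_eval_reflect wall_reflection_wall_reflection)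
qed simp

lemma foldr_reflect_affine_root:
  "set as \<subseteq> simple_affine_roots \<Longrightarrow> f \<in> affine_roots \<Longrightarrow> foldr reflect as f \<in> affine_roots"
  by (induction as) (simp_all add: simple_affine_root reflect_affine_root)

lemma foldr_reflect_rev:
  "set as \<subseteq> simple_affine_roots \<Longrightarrow> foldr reflect (rev as) (foldr reflect as f) = f"
  by (induction as) (simp_all add: simple_affine_root reflect_reflect)

text \<open>Read from the right, the word has a first letter \<open>c\<close> that turns the root
  negative. By \<open>reflect_positive\<close> the root has then just become \<open>c\<close>
  itself, and undoing the letters applied so far exhibits \<open>f\<close> in the orbit of
  \<open>c\<close>.\<close>

lemma orbit_of_turned_negative:
  assumes "set as \<subseteq> simple_affine_roots" "f \<in> positive_affine_roots"
    "foldr reflect as f \<notin> positive_affine_roots"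
  shows "\<exists>bs a. set bs \<subseteq> simple_affine_roots \<and> a \<in> simple_affine_roots \<and> f = foldr reflect bs a"
  using assms
proof (induction as)
  case (Cons c cs)
  show ?case
  proof (cases "foldr reflect cs f \<in> positive_affine_roots")
    case True
    then have "foldr reflect cs f = c"
      using Cons.prems reflect_positive[of c "foldr reflect cs f"] by force
    then have "f = foldr reflect (rev cs) c"
      using foldr_reflect_rev Cons.prems by (metis list.set_intros(2) subset_code(1))
    then show ?thesis
      using Cons.prems by (intro exI[of _ "rev cs"] exI[of _ c]) auto
  next
    case False
    then show ?thesis
      using Cons by auto
  qed
qed simp

lemma positive_affine_root_in_orbit:
  assumes "f \<in> positive_affine_roots"
  shows "\<exists>bs a. set bs \<subseteq> simple_affine_roots \<and> a \<in> simple_affine_roots \<and> f = foldr reflect bs a"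
proof -
  have ff: "0 < fst f \<bullet> fst f"
    using assms positive_affine_roots_subset fst_affine_root_pos by blast
  \<comment> \<open>The multiple of the linear part at which \<open>f\<close> has the value -1. Once
    \<open>p\<close> is moved into the alcove, the image of \<open>f\<close> is negative
    there.\<close>
  define p where "p = - ((snd f + 1) / (fst f \<bullet> fst f)) *\<^sub>R fst f"
  have "affine_eval f p = -1"
    using ff by (simp add: p_def affine_eval_def)
  moreover obtain as where as: "set as \<subseteq> simple_affine_roots" "foldr wall_reflection as p \<in> alcove"
    using move_into_alcove by blast
  ultimately have "affine_eval (foldr reflect as f) (foldr wall_reflection as p) < 0"
    by (simp add: affine_eval_foldr)
  then have "foldr reflect as f \<notin> positive_affine_roots"
    using positive_on_alcove[OF _ as(2)] not_le by blast
  then show ?thesis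
    using orbit_of_turned_negative as assms by blast
qed

lemma affine_root_in_orbit:
  assumes "f \<in> affine_roots"
  shows "\<exists>bs a. set bs \<subseteq> simple_affine_roots \<and> a \<in> simple_affine_roots \<and> f = foldr reflect bs a"
proof (cases "f \<in> positive_affine_roots")
  case False
  then obtain bs a where ba: "set bs \<subseteq> simple_affine_roots" "a \<in> simple_affine_roots"
    "- f = foldr reflect bs a"
    using affine_root_sign assms positive_affine_root_in_orbit by blast
  have neg: "foldr reflect bs (- a) = - foldr reflect bs a"
    by (induction bs) (simp_all add: reflect_def pairing_def)
  \<comment> \<open>If -f = w a, then f = w (-a), and -a is the reflection of \<open>a\<close> in
    itself; hence the extra letter.\<close>
  have "f = foldr reflect (bs @ [a]) a"
    using neg ba(3)[symmetric] reflect_self[OF simple_affine_root[OF ba(2)]] by simp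
  then show ?thesis
    using ba by (intro exI[of _ "bs @ [a]"] exI[of _ a]) auto
qed (use positive_affine_root_in_orbit in blast)

lemma wall_reflection_foldr:
  assumes "set bs \<subseteq> simple_affine_roots"
  shows "wall_reflection (foldr reflect bs f) x =
    foldr wall_reflection bs (wall_reflection f (foldr wall_reflection (rev bs) x))"
  using assms
proof (induction bs arbitrary: x)
  case (Cons b bs)
  then have "fst b \<noteq> 0"
    using simple_affine_root fst_affine_root_nonzero by simp
  then show ?case
    using Cons by (simp add: wall_reflection_reflect)
qed simp

text \<open>Every affine root is an image of a simple one, so its reflection is conjugate to a
  simple reflection. Hence the walls generate the affine Weyl group, which is defined from all
  reflections.\<close>

lemma wall_reflection_word:
  assumes "f \<in> affine_roots"
  shows "\<exists>as. set as \<subseteq> simple_affine_roots \<and> wall_reflection f = foldr wall_reflection as"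
proof -
  obtain bs a where ba: "set bs \<subseteq> simple_affine_roots" "a \<in> simple_affine_roots" "f = foldr reflect bs a"
    using affine_root_in_orbit assms by blast
  then have "wall_reflection f = foldr wall_reflection (bs @ [a] @ rev bs)"
    by (auto simp: wall_reflection_foldr)
  then show ?thesis
    using ba by (intro exI[of _ "bs @ [a] @ rev bs"]) auto
qed

end

section \<open>Orders of products of two simple reflections\<close>

lemma funpow_eq_id_iff_dvd:
  assumes "f ^^ m = id" "0 < m" "\<And>j. 0 < j \<Longrightarrow> j < m \<Longrightarrow> f ^^ j \<noteq> id"
  shows "f ^^ n = id \<longleftrightarrow> m dvd n"
proof -
  have "f ^^ n = f ^^ (n mod m) \<circ> (f ^^ m) ^^ (n div m)"
    by (metis funpow_add funpow_mult mod_mult_div_eq)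
  also have "(f ^^ m) ^^ (n div m) = id"
    using assms(1) by simp
  finally have "f ^^ n = f ^^ (n mod m)"
    by simp
  moreover have "f ^^ (n mod m) = id \<longleftrightarrow> n mod m = 0"
    using assms(2) assms(3)[of "n mod m"] by (cases "n mod m = 0") auto
  ultimately show ?thesis
    by (simp add: dvd_eq_mod_eq_0)
qed

text \<open>The product of two reflections, in the coordinates given by the two reflected vectors and
  relative to a starting vector; \<open>p\<close> and \<open>q\<close> are the Cartan numbers of the two vectors, \<open>u\<close> and
  \<open>v\<close> their pairings with the starting vector.\<close>

definition rotation_step :: "real \<Rightarrow> real \<Rightarrow> real \<Rightarrow> real \<Rightarrow> real \<times> real \<Rightarrow> real \<times> real" where
  "rotation_step p q u v c =
     (- fst c - u - q * snd c, - snd c - v - p * (- fst c - u - q * snd c))"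

context based_root_system
begin

abbreviation rotation :: "'a \<times> real \<Rightarrow> 'a \<times> real \<Rightarrow> 'a \<times> real \<Rightarrow> 'a \<times> real" where
  "rotation a b \<equiv> reflect b \<circ> reflect a"

text \<open>Both reflections change a function by multiples of \<open>a\<close> and \<open>b\<close>
  only, so the powers of their product reduce to a numerical recursion for the two
  coefficients.\<close>

lemma rotation_funpow_coords:
  assumes "a \<in> affine_roots" "b \<in> affine_roots"
  shows "(rotation a b ^^ n) f = f + fst ((rotation_step (pairing a b) (pairing b a) (pairing f a) (pairing f b) ^^ n) (0, 0)) *\<^sub>R a
    + snd ((rotation_step (pairing a b) (pairing b a) (pairing f a) (pairing f b) ^^ n) (0, 0)) *\<^sub>R b"
proof (induction n)
  case (Suc n)
  have self: "pairing a a = 2" "pairing b b = 2"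
    using fst_affine_root_pos assms by (auto simp: pairing_def)
  have lin: "pairing (g + x *\<^sub>R a + y *\<^sub>R b) d = pairing g d + x * pairing a d + y * pairing b d"
    for g x y and d :: "'a \<times> real"
    by (simp add: pairing_def inner_add_left add_divide_distrib algebra_simps)
  have "rotation a b (f + x *\<^sub>R a + y *\<^sub>R b) =
      f + (- x - pairing f a - pairing b a * y) *\<^sub>R a +
      (- y - pairing f b - pairing a b * (- x - pairing f a - pairing b a * y)) *\<^sub>R b" for x y
  proof -
    have "reflect a (f + x *\<^sub>R a + y *\<^sub>R b) = f + (- x - pairing f a - pairing b a * y) *\<^sub>R a + y *\<^sub>R b"
      unfolding reflect_def lin self by (simp add: algebra_simps flip: scaleR_add_left)
    moreover have "reflect b (f + x' *\<^sub>R a + y *\<^sub>R b) = f + x' *\<^sub>R a + (- y - pairing f b - pairing a b * x') *\<^sub>R b" for x'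
      unfolding reflect_def lin self by (simp add: algebra_simps flip: scaleR_add_left)
    ultimately show ?thesis
      by simp
  qed
  then show ?case
    using Suc by (simp add: rotation_step_def)
qed simp

lemma proportional_simple_affine_roots:
  assumes "a \<in> simple_affine_roots" "b \<in> simple_affine_roots" "a \<noteq> b"
  shows "b \<noteq> c *\<^sub>R a"
proof
  assume "b = c *\<^sub>R a"
  then have "b = - a"
    using proportional_affine_roots[of b a c] simple_affine_root assms by simp
  then show False
    using simple_affine_root_positive[OF assms(1)] simple_affine_root_positive[OF assms(2)]
      positive_affine_roots_antisym[of a] by simp
qed

lemma simple_affine_inner_nonpos:
  assumes "a \<in> simple_affine_roots" "b \<in> simple_affine_roots" "a \<noteq> b"
  shows "fst a \<bullet> fst b \<le> 0"
proof -
  have cases: "(\<exists>\<alpha>\<in>D. c = (\<alpha>, 0)) \<or> (\<exists>\<theta>\<in>H. c = (- \<theta>, 1))" if "c \<in> simple_affine_roots" for c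
    using that by (auto simp: simple_affine_roots_def)
  show ?thesis
    using cases[OF assms(1)] cases[OF assms(2)]
  proof (elim disjE bexE)
    fix \<alpha> \<beta> assume "\<alpha> \<in> D" "\<beta> \<in> D" "a = (\<alpha>, 0)" "b = (\<beta>, 0)"
    then show ?thesis
      using simple_inner_nonpos[of \<alpha> \<beta>] assms(3) by simp
  next
    fix \<alpha> \<theta> assume "\<alpha> \<in> D" "\<theta> \<in> H" "a = (\<alpha>, 0)" "b = (- \<theta>, 1)"
    then show ?thesis
      using highest_dominant[of \<theta> \<alpha>] by (simp add: inner_commute)
  next
    fix \<theta> \<alpha> assume "\<theta> \<in> H" "\<alpha> \<in> D" "a = (- \<theta>, 1)" "b = (\<alpha>, 0)"
    then show ?thesis
      using highest_dominant[of \<theta> \<alpha>] by simp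
  next
    fix \<theta> \<theta>' assume "\<theta> \<in> H" "\<theta>' \<in> H" "a = (- \<theta>, 1)" "b = (- \<theta>', 1)"
    then show ?thesis
      using highest_inner_nonpos[of \<theta> \<theta>'] assms(3) by simp
  qed
qed

text \<open>Parallel walls, as in a component of rank one: \<open>a + b\<close> is a nonzero
  constant function, and the n-th power of the product sends \<open>a\<close> to a - 2 n (a +
  b).\<close>

lemma rotation_order_antiparallel:
  assumes "a \<in> simple_affine_roots" "b \<in> simple_affine_roots" "a \<noteq> b" "fst b = - fst a" "0 < n"
  shows "rotation a b ^^ n \<noteq> id"
proof
  have a: "a \<in> affine_roots" "b \<in> affine_roots"
    using assms simple_affine_root by auto
  have p: "pairing a b = -2" "pairing b a = -2" "pairing a a = 2"
    using fst_affine_root_pos[OF a(1)] assms(4) by (auto simp: pairing_def)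
  have "(rotation_step (-2) (-2) 2 (-2) ^^ n) (0, 0) = (- 2 * real n, - 2 * real n)" for n
    by (induction n) (auto simp: rotation_step_def)
  then have "(rotation a b ^^ n) a = a - (2 * real n) *\<^sub>R (a + b)"
    unfolding rotation_funpow_coords[OF a] p by (simp add: algebra_simps)
  moreover assume "rotation a b ^^ n = id"
  ultimately have "a + b = 0"
    using assms(5) by simp
  then have "b = (-1) *\<^sub>R a"
    by (simp add: eq_neg_iff_add_eq_0 add.commute)
  then show False
    using proportional_simple_affine_roots assms by blast
qed

text \<open>Up to exchange the Cartan numbers are (0, 0), (-1, -1), (-1, -2) or (-1, -3). Their
  product is four times the squared cosine, and the orders are 2, 3, 4 and 6. The divisibility form
  is what the order in \<open>W\<close> is matched against later.\<close>

lemma rotation_order: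
  assumes "a \<in> simple_affine_roots" "b \<in> simple_affine_roots" "a \<noteq> b" "fst b \<noteq> - fst a"
  shows "\<exists>m>0. (\<forall>n. rotation a b ^^ n = id \<longleftrightarrow> m dvd n) \<and>
    fst a \<bullet> fst b / (norm (fst a) * norm (fst b)) = - cos (pi / real m)"
proof -
  define p q where "p = pairing a b" and "q = pairing b a"
  let ?c = "fst a \<bullet> fst b / (norm (fst a) * norm (fst b))"
  have aff: "a \<in> affine_roots" "b \<in> affine_roots"
    using assms simple_affine_root by auto
  have R: "fst a \<in> R" "fst b \<in> R"
    using aff fst_affine_root by auto
  have pos: "0 < fst a \<bullet> fst a" "0 < fst b \<bullet> fst b"
    using aff fst_affine_root_pos by auto
  have ab: "fst a \<bullet> fst b \<le> 0"
    using simple_affine_inner_nonpos assms by blast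
  then have ne: "fst b \<noteq> fst a"
    using pos by (metis not_less)
  have self: "pairing a a = 2"
    using pos by (simp add: pairing_def)
  have "?c \<le> 0"
    using ab by (simp add: divide_le_0_iff mult_less_0_iff not_less)
  moreover have "?c\<^sup>2 = p * q / 4"
    using pos by (simp add: p_def q_def pairing_def power_divide power_mult_distrib
        dot_square_norm inner_commute power2_eq_square)
  ultimately have c: "?c = - sqrt (p * q / 4)"
    by (metis abs_of_nonpos minus_minus real_sqrt_abs)
  have indep: "x = 0 \<and> y = 0" if "x *\<^sub>R fst a + y *\<^sub>R fst b = 0" for x y
  proof (cases "y = 0")
    case True
    then show ?thesis
      using that pos by auto
  next
    case False
    have "fst b = (- x / y) *\<^sub>R fst a"
    proof -
      have "y *\<^sub>R fst b = - x *\<^sub>R fst a"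
        using that by (simp add: eq_neg_iff_add_eq_0 add.commute)
      then have "(1 / y) *\<^sub>R (y *\<^sub>R fst b) = (1 / y) *\<^sub>R (- x *\<^sub>R fst a)"
        by simp
      then show ?thesis
        using False by simp
    qed
    then have "- x / y = 1 \<or> - x / y = -1"
      using proportional_roots[OF R(1), of "- x / y"] R(2) by metis
    then show ?thesis
      using \<open>fst b = (- x / y) *\<^sub>R fst a\<close> ne assms(4) by (metis scaleR_minus_left scaleR_one)
  qed
  \<comment> \<open>It suffices to run the recursion: the m-th power must return to (0, 0) for
    arbitrary initial pairings \<open>u\<close> and \<open>v\<close>, and no smaller power may fix
    \<open>a\<close>, whose own pairings are 2 and \<open>p\<close>.\<close>
  have order: "\<forall>n. rotation a b ^^ n = id \<longleftrightarrow> m dvd n"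
    if "0 < m" "\<And>u v. (rotation_step p q u v ^^ m) (0, 0) = (0, 0)"
      "\<And>j. 0 < j \<Longrightarrow> j < m \<Longrightarrow> (rotation_step p q 2 p ^^ j) (0, 0) \<noteq> (0, 0)" for m
  proof
    fix n
    have id: "rotation a b ^^ m = id"
      using that(2) by (intro ext) (simp add: rotation_funpow_coords[OF aff] p_def q_def)
    have "rotation a b ^^ j \<noteq> id" if j: "0 < j" "j < m" for j
    proof
      assume "rotation a b ^^ j = id"
      then have "(rotation a b ^^ j) a = a"
        by simp
      then have "fst ((rotation_step p q 2 p ^^ j) (0, 0)) *\<^sub>R fst a +
          snd ((rotation_step p q 2 p ^^ j) (0, 0)) *\<^sub>R fst b = 0"
        unfolding rotation_funpow_coords[OF aff] self p_def q_def
        by (metis (no_types, lifting) add.assoc add_cancel_left_right fst_add fst_scaleR fst_zero)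
      then show False
        using indep \<open>_ \<Longrightarrow> _ \<Longrightarrow> _ \<noteq> (0, 0)\<close>[OF j] by (simp add: prod_eq_iff)
    qed
    then show "rotation a b ^^ n = id \<longleftrightarrow> m dvd n"
      using funpow_eq_id_iff_dvd[OF id \<open>0 < m\<close>] by blast
  qed
  have lt2: "j = 1" if "0 < j" "j < 2" for j :: nat using that by simp
  have lt3: "j = 1 \<or> j = 2" if "0 < j" "j < 3" for j :: nat using that by auto
  have lt4: "j = 1 \<or> j = 2 \<or> j = 3" if "0 < j" "j < 4" for j :: nat using that by auto
  have lt6: "j = 1 \<or> j = 2 \<or> j = 3 \<or> j = 4 \<or> j = 5" if "0 < j" "j < 6" for j :: nat using that by auto
  consider "p = 0" "q = 0" | "p = -1" "q = -1" | "p = -1" "q = -2" | "p = -2" "q = -1"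
    | "p = -1" "q = -3" | "p = -3" "q = -1"
  proof (cases "fst a \<bullet> fst b = 0")
    case True
    then have "p = 0" "q = 0"
      by (auto simp: p_def q_def pairing_def inner_commute)
    then show ?thesis
      using that by blast
  next
    case False
    obtain m n :: int where mn: "q = of_int m" "p = of_int n" "0 < m * n" "m * n < 4"
      using cartan_product[OF R False ne assms(4)]
      unfolding p_def q_def pairing_def by (metis inner_commute)
    have "p \<le> 0" "q \<le> 0"
      using ab by (auto simp: p_def q_def pairing_def inner_commute divide_le_0_iff)
    then have "m < 0" "n < 0"
      using mn by (auto simp: zero_less_mult_iff)
    moreover have "- 3 \<le> m" "- 3 \<le> n"
      using calculation mn(4) mult_mono[of 1 "- n" 4 "- m"] mult_mono[of 1 "- m" 4 "- n"] by (auto simp: mult.commute intro!: leI)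
    ultimately have "m \<in> {-3, -2, -1}" "n \<in> {-3, -2, -1}"
      by auto
    then show ?thesis
      using mn that by auto
  qed
  moreover have fin: ?thesis
    if "0 < m" "\<And>u v. (rotation_step p q u v ^^ m) (0, 0) = (0, 0)"
      "\<And>j. 0 < j \<Longrightarrow> j < m \<Longrightarrow> (rotation_step p q 2 p ^^ j) (0, 0) \<noteq> (0, 0)"
      "sqrt (p * q / 4) = cos (pi / real m)" for m
    using order[OF that(1-3)] that(1,4) c by auto
  ultimately show ?thesis
  proof cases
    case 1
    show ?thesis
    proof (rule fin)
      show "sqrt (p * q / 4) = cos (pi / real 2)"
        unfolding 1 by simp
    next
      show "(rotation_step p q u v ^^ 2) (0, 0) = (0, 0)" for u v
        unfolding 1 by (simp add: rotation_step_def eval_nat_numeral)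
    next
      show "(rotation_step p q 2 p ^^ j) (0, 0) \<noteq> (0, 0)" if "0 < j" "j < 2" for j
        using lt2[OF that] unfolding 1 by (auto simp: rotation_step_def eval_nat_numeral)
    qed simp
  next
    case 2
    show ?thesis
    proof (rule fin)
      show "sqrt (p * q / 4) = cos (pi / real 3)"
        unfolding 2 by (simp add: cos_60 real_sqrt_divide)
    next
      show "(rotation_step p q u v ^^ 3) (0, 0) = (0, 0)" for u v
        unfolding 2 by (simp add: rotation_step_def eval_nat_numeral)
    next
      show "(rotation_step p q 2 p ^^ j) (0, 0) \<noteq> (0, 0)" if "0 < j" "j < 3" for j
        using lt3[OF that] unfolding 2 by (auto simp: rotation_step_def eval_nat_numeral)
    qed simp
  next
    case 3
    show ?thesis
    proof (rule fin)
      show "sqrt (p * q / 4) = cos (pi / real 4)"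
        unfolding 3 by (simp add: cos_45 real_sqrt_divide real_div_sqrt)
    next
      show "(rotation_step p q u v ^^ 4) (0, 0) = (0, 0)" for u v
        unfolding 3 by (simp add: rotation_step_def eval_nat_numeral)
    next
      show "(rotation_step p q 2 p ^^ j) (0, 0) \<noteq> (0, 0)" if "0 < j" "j < 4" for j
        using lt4[OF that] unfolding 3 by (auto simp: rotation_step_def eval_nat_numeral)
    qed simp
  next
    case 4
    show ?thesis
    proof (rule fin)
      show "sqrt (p * q / 4) = cos (pi / real 4)"
        unfolding 4 by (simp add: cos_45 real_sqrt_divide real_div_sqrt)
    next
      show "(rotation_step p q u v ^^ 4) (0, 0) = (0, 0)" for u v
        unfolding 4 by (simp add: rotation_step_def eval_nat_numeral)
    next
      show "(rotation_step p q 2 p ^^ j) (0, 0) \<noteq> (0, 0)" if "0 < j" "j < 4" for j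
        using lt4[OF that] unfolding 4 by (auto simp: rotation_step_def eval_nat_numeral)
    qed simp
  next
    case 5
    show ?thesis
    proof (rule fin)
      show "sqrt (p * q / 4) = cos (pi / real 6)"
        unfolding 5 by (simp add: cos_30 real_sqrt_divide)
    next
      show "(rotation_step p q u v ^^ 6) (0, 0) = (0, 0)" for u v
        unfolding 5 by (simp add: rotation_step_def eval_nat_numeral)
    next
      show "(rotation_step p q 2 p ^^ j) (0, 0) \<noteq> (0, 0)" if "0 < j" "j < 6" for j
        using lt6[OF that] unfolding 5 by (auto simp: rotation_step_def eval_nat_numeral)
    qed simp
  next
    case 6
    show ?thesis
    proof (rule fin)
      show "sqrt (p * q / 4) = cos (pi / real 6)"
        unfolding 6 by (simp add: cos_30 real_sqrt_divide)
    next
      show "(rotation_step p q u v ^^ 6) (0, 0) = (0, 0)" for u v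
        unfolding 6 by (simp add: rotation_step_def eval_nat_numeral)
    next
      show "(rotation_step p q 2 p ^^ j) (0, 0) \<noteq> (0, 0)" if "0 < j" "j < 6" for j
        using lt6[OF that] unfolding 6 by (auto simp: rotation_step_def eval_nat_numeral)
    qed simp
  qed
qed

end

section \<open>The affine Weyl group as words in the wall reflections\<close>

lemma restrict_UNIV: "restrict f UNIV = f"
  by (simp add: restrict_def)

lemma BijGroup_UNIV_mult:
  "f \<in> Bij UNIV \<Longrightarrow> g \<in> Bij UNIV \<Longrightarrow> f \<otimes>\<^bsub>BijGroup UNIV\<^esub> g = f \<circ> g"
  by (simp add: BijGroup_def compose_def o_def restrict_UNIV)

lemma BijGroup_UNIV_one: "\<one>\<^bsub>BijGroup UNIV\<^esub> = id"
  by (simp add: BijGroup_def id_def restrict_UNIV)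

context based_root_system
begin

lemma wall_reflection_Bij:
  assumes "f \<in> affine_roots"
  shows "wall_reflection f \<in> Bij UNIV"
proof -
  have "bij (wall_reflection f)"
    using wall_reflection_wall_reflection[OF fst_affine_root_nonzero[OF assms]]
    by (intro o_bij[of "wall_reflection f"] ext) simp_all
  then show ?thesis
    by (simp add: Bij_def)
qed

lemma affine_weyl_generators:
  "{affine_reflection \<alpha> (of_int k) | \<alpha> k. \<alpha> \<in> R} = wall_reflection ` affine_roots"
proof (intro equalityI subsetI)
  fix g :: "'a \<Rightarrow> 'a" assume "g \<in> {affine_reflection \<alpha> (of_int k) | \<alpha> k. \<alpha> \<in> R}"
  then obtain \<alpha> and k :: int where "\<alpha> \<in> R" "g = affine_reflection \<alpha> (of_int k)"
    by blast
  then have "g = wall_reflection (\<alpha>, - of_int k)" "(\<alpha>, - of_int k) \<in> affine_roots"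
    by (simp_all add: wall_reflection_def affine_roots_def)
  then show "g \<in> wall_reflection ` affine_roots"
    by blast
next
  fix g :: "'a \<Rightarrow> 'a" assume "g \<in> wall_reflection ` affine_roots"
  then obtain f where f: "f \<in> affine_roots" "g = wall_reflection f"
    by blast
  then obtain k :: int where "- snd f = of_int k"
    using Ints_minus[of "snd f"] unfolding affine_roots_def
    by (metis Ints_cases mem_Times_iff)
  then show "g \<in> {affine_reflection \<alpha> (of_int k) | \<alpha> k. \<alpha> \<in> R}"
    using f fst_affine_root[OF f(1)] unfolding wall_reflection_def by auto
qed

lemma carrier_affine_weyl_group:
  "carrier (affine_weyl_group R) = generate (BijGroup UNIV) (wall_reflection ` affine_roots)"
proof -
  have "carrier (BijGroup UNIV) \<inter> wall_reflection ` affine_roots = wall_reflection ` affine_roots"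
    using wall_reflection_Bij by (auto simp: BijGroup_def)
  then show ?thesis
    unfolding affine_weyl_group_def affine_weyl_generators carrier_subgroup_generated by simp
qed

lemma foldr_wall_reflection_Bij:
  "set as \<subseteq> simple_affine_roots \<Longrightarrow> foldr wall_reflection as \<in> Bij UNIV"
proof (induction as)
  case Nil
  then show ?case
    by (simp add: Bij_def id_def bij_betw_def)
next
  case (Cons a as)
  then have "wall_reflection a \<in> Bij UNIV" "foldr wall_reflection as \<in> Bij UNIV"
    using wall_reflection_Bij simple_affine_root by auto
  then show ?case
    using bij_comp[of "foldr wall_reflection as" "wall_reflection a"] by (simp add: Bij_def o_def)
qed

lemma affine_weyl_group_word:
  assumes "g \<in> carrier (affine_weyl_group R)"
  shows "\<exists>as. set as \<subseteq> simple_affine_roots \<and> g = foldr wall_reflection as"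
  using assms unfolding carrier_affine_weyl_group
proof (induction rule: generate.induct)
  case one
  show ?case
    unfolding BijGroup_UNIV_one by (intro exI[of _ "[]"]) simp
next
  case (incl h)
  then show ?case
    using wall_reflection_word by blast
next
  case (inv h)
  then obtain f where f: "f \<in> affine_roots" "h = wall_reflection f"
    by blast
  then have "h \<in> Bij UNIV"
    using wall_reflection_Bij by blast
  moreover have "h \<circ> h = id"
    unfolding f(2) using wall_reflection_wall_reflection[OF fst_affine_root_nonzero[OF f(1)]] by auto
  then have "h \<otimes>\<^bsub>BijGroup UNIV\<^esub> h = \<one>\<^bsub>BijGroup UNIV\<^esub>"
    unfolding BijGroup_UNIV_mult[OF \<open>h \<in> Bij UNIV\<close> \<open>h \<in> Bij UNIV\<close>] BijGroup_UNIV_one .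
  ultimately have "inv\<^bsub>BijGroup UNIV\<^esub> h = h"
    by (intro group.inv_equality[OF group_BijGroup]) (simp_all add: BijGroup_def)
  then show ?case
    using wall_reflection_word f by metis
next
  case (eng g h)
  then obtain as bs where "set as \<subseteq> simple_affine_roots" "g = foldr wall_reflection as"
    "set bs \<subseteq> simple_affine_roots" "h = foldr wall_reflection bs"
    by blast
  then show ?case
    using foldr_wall_reflection_Bij
    by (intro exI[of _ "as @ bs"]) (simp add: BijGroup_UNIV_mult)
qed

lemma affine_weyl_group_mult:
  assumes "g \<in> carrier (affine_weyl_group R)" "h \<in> carrier (affine_weyl_group R)"
  shows "g \<otimes>\<^bsub>affine_weyl_group R\<^esub> h = g \<circ> h"
proof -
  have "g \<in> Bij UNIV" "h \<in> Bij UNIV"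
    using affine_weyl_group_word[OF assms(1)] affine_weyl_group_word[OF assms(2)]
      foldr_wall_reflection_Bij by auto
  then show ?thesis
    by (simp add: affine_weyl_group_def subgroup_generated_def BijGroup_UNIV_mult)
qed

lemma affine_weyl_group_one: "\<one>\<^bsub>affine_weyl_group R\<^esub> = id"
  using BijGroup_UNIV_one by (simp add: affine_weyl_group_def subgroup_generated_def)

lemma group_affine_weyl_group: "group (affine_weyl_group R)"
  unfolding affine_weyl_group_def using group.group_subgroup_generated[OF group_BijGroup] .

text \<open>Equal reflections act equally on functions. Applied to \<open>a\<close>, one gives -a
  and the other \<open>a\<close> minus a multiple of \<open>b\<close>, so \<open>a\<close> would be
  proportional to \<open>b\<close>. This lets a generator determine its wall.\<close>

lemma inj_on_wall_reflection: "inj_on wall_reflection simple_affine_roots"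
proof (rule inj_onI, rule ccontr)
  fix a b assume ab: "a \<in> simple_affine_roots" "b \<in> simple_affine_roots"
    "wall_reflection a = wall_reflection b" "a \<noteq> b"
  then have "reflect a a = reflect b a"
    unfolding affine_eval_inject[symmetric] affine_eval_reflect by simp
  then have *: "2 *\<^sub>R a = pairing a b *\<^sub>R b"
    using reflect_self[OF simple_affine_root[OF ab(1)]]
    by (simp add: reflect_def scaleR_2 algebra_simps)
  then have "(1 / 2) *\<^sub>R (2 *\<^sub>R a) = (1 / 2) *\<^sub>R (pairing a b *\<^sub>R b)"
    by simp
  then have "a = (pairing a b / 2) *\<^sub>R b"
    by simp
  then show False
    using proportional_simple_affine_roots[OF ab(2,1)] ab(4) by blast
qed

text \<open>Functions transform contravariantly, so the two reflections appear in opposite orders on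
  functions and on points.\<close>

lemma affine_eval_rotation_funpow:
  "affine_eval ((rotation a b ^^ n) f) x = affine_eval f (((wall_reflection a \<circ> wall_reflection b) ^^ n) x)"
proof (induction n arbitrary: x)
  case (Suc n)
  have "affine_eval ((rotation a b ^^ Suc n) f) x =
      affine_eval ((rotation a b ^^ n) f) ((wall_reflection a \<circ> wall_reflection b) x)"
    by (simp add: affine_eval_reflect)
  also have "\<dots> = affine_eval f (((wall_reflection a \<circ> wall_reflection b) ^^ Suc n) x)"
    unfolding Suc by (simp only: funpow_Suc_right o_apply)
  finally show ?case .
qed simp

lemma wall_reflections_funpow_eq_id:
  "(wall_reflection a \<circ> wall_reflection b) ^^ n = id \<longleftrightarrow> rotation a b ^^ n = id"
proof
  assume eq: "(wall_reflection a \<circ> wall_reflection b) ^^ n = id"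
  show "rotation a b ^^ n = id"
  proof
    fix f
    show "(rotation a b ^^ n) f = id f"
      unfolding affine_eval_inject[symmetric] affine_eval_rotation_funpow eq by simp
  qed
next
  assume eq: "rotation a b ^^ n = id"
  show "(wall_reflection a \<circ> wall_reflection b) ^^ n = id"
  proof
    fix x
    let ?y = "((wall_reflection a \<circ> wall_reflection b) ^^ n) x"
    have "affine_eval f ?y = affine_eval f x" for f
      unfolding affine_eval_rotation_funpow[symmetric] eq by simp
    then have "z \<bullet> ?y = z \<bullet> x" for z
      using spec[of _ "(z, 0)"] by (metis (no_types, lifting) add.right_neutral affine_eval_def fst_conv snd_conv)
    then show "?y = id x"
      using vector_eq_rdot[of ?y x] by (simp add: inner_commute)
  qed
qed

end

section \<open>The root system of an affine Coxeter system\<close>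

locale affine_coxeter = based_root_system R D
  for R D :: "'a::euclidean_space set" +
  fixes W :: "('g, 'b) monoid_scheme" and S :: "'g set" and \<phi> :: "'g \<Rightarrow> 'a \<Rightarrow> 'a"
  assumes group_W: "group W"
    and S_subset: "S \<subseteq> carrier W"
    and iso: "\<phi> \<in> iso W (affine_weyl_group R)"
    and generators: "\<phi> ` S = affine_generators R D"
begin

lemma \<phi>_carrier: "w \<in> carrier W \<Longrightarrow> \<phi> w \<in> carrier (affine_weyl_group R)"
  using iso by (auto simp: iso_def hom_def)

lemma \<phi>_mult: "v \<in> carrier W \<Longrightarrow> w \<in> carrier W \<Longrightarrow> \<phi> (v \<otimes>\<^bsub>W\<^esub> w) = \<phi> v \<circ> \<phi> w"
  using iso affine_weyl_group_mult[OF \<phi>_carrier \<phi>_carrier] by (simp add: iso_def hom_def)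

lemma \<phi>_one: "\<phi> \<one>\<^bsub>W\<^esub> = id"
  using hom_one[OF _ group_W group_affine_weyl_group] iso affine_weyl_group_one
  unfolding iso_def by auto

lemma \<phi>_inj: "inj_on \<phi> (carrier W)" and \<phi>_image: "\<phi> ` carrier W = carrier (affine_weyl_group R)"
  using iso by (auto simp: iso_def bij_betw_def)

lemma \<phi>_eq_id: "w \<in> carrier W \<Longrightarrow> \<phi> w = id \<longleftrightarrow> w = \<one>\<^bsub>W\<^esub>"
  using \<phi>_one \<phi>_inj group.is_monoid[OF group_W, THEN monoid.one_closed] by (metis inj_onD)

lemma \<phi>_inv: "w \<in> carrier W \<Longrightarrow> \<phi> (inv\<^bsub>W\<^esub> w) (\<phi> w x) = x"
  using \<phi>_mult[of "inv\<^bsub>W\<^esub> w" w] \<phi>_one group.inv_closed[OF group_W] group.l_inv[OF group_W]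
  by (metis comp_apply id_apply)

lemma \<phi>_pow:
  assumes "w \<in> carrier W"
  shows "\<phi> (w [^]\<^bsub>W\<^esub> (n::nat)) = \<phi> w ^^ n"
proof (induction n)
  case 0
  then show ?case
    using \<phi>_one group.is_monoid[OF group_W] by (simp add: monoid.nat_pow_0 id_def)
next
  case (Suc n)
  then show ?case
    using assms \<phi>_mult group.is_monoid[OF group_W]
    by (simp add: monoid.nat_pow_Suc monoid.nat_pow_closed funpow_Suc_right del: funpow.simps(2))
qed

section \<open>Walls of the generators and the Coxeter form\<close>

definition wall :: "'g \<Rightarrow> 'a \<times> real" where
  "wall s = inv_into simple_affine_roots wall_reflection (\<phi> s)"

lemma wall:
  assumes "s \<in> S"
  shows "wall s \<in> simple_affine_roots" "wall_reflection (wall s) = \<phi> s"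
proof -
  have "\<phi> s \<in> wall_reflection ` simple_affine_roots"
    using assms generators affine_generators_eq by blast
  then show "wall s \<in> simple_affine_roots" "wall_reflection (wall s) = \<phi> s"
    unfolding wall_def by (rule inv_into_into, rule f_inv_into_f)
qed

lemma wall_affine_root: "s \<in> S \<Longrightarrow> wall s \<in> affine_roots"
  using wall(1) simple_affine_root by blast

lemma bij_betw_wall: "bij_betw wall S simple_affine_roots"
proof (rule bij_betw_imageI)
  show "inj_on wall S"
    using wall(2) inj_on_subset[OF \<phi>_inj S_subset] by (metis inj_on_def)
  show "wall ` S = simple_affine_roots"
  proof (intro equalityI subsetI)
    fix a assume a: "a \<in> simple_affine_roots"
    then obtain s where "s \<in> S" "\<phi> s = wall_reflection a"
      using generators unfolding affine_generators_eq by (metis imageE imageI)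
    then have "wall s = a"
      using a inj_on_wall_reflection by (simp add: wall_def)
    then show "a \<in> wall ` S"
      using \<open>s \<in> S\<close> by blast
  qed (use wall(1) in blast)
qed

lemma finite_S: "finite S"
  using bij_betw_wall finite_simple_affine_roots bij_betw_finite by blast

text \<open>Powers of the product of \<open>s\<close> and \<open>t\<close> are transported through
  \<phi> to powers of the rotation. Equal generators give order 1 and -cos \<pi> = 1, opposite
  linear parts give infinite order and -1, and \<open>rotation_order\<close> settles the
  rest.\<close>

lemma simple_form_wall:
  assumes "s \<in> S" "t \<in> S"
  shows "simple_form W s t = fst (wall s) \<bullet> fst (wall t) / (norm (fst (wall s)) * norm (fst (wall t)))"
proof -
  interpret group W by (rule group_W)
  have st: "s \<in> carrier W" "t \<in> carrier W"
    using assms S_subset by auto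
  then have \<phi>st: "\<phi> (s \<otimes>\<^bsub>W\<^esub> t) = wall_reflection (wall s) \<circ> wall_reflection (wall t)"
    using \<phi>_mult wall(2) assms by simp
  show ?thesis
  proof (cases "s = t")
    case True
    have "fst (wall s) \<noteq> 0"
      using wall_affine_root[OF assms(1)] fst_affine_root_nonzero by blast
    then have "\<phi> (s \<otimes>\<^bsub>W\<^esub> t) = id"
      unfolding \<phi>st using True by (auto simp: wall_reflection_wall_reflection)
    then have "s \<otimes>\<^bsub>W\<^esub> t = \<one>\<^bsub>W\<^esub>"
      using \<phi>_eq_id st by blast
    then have "simple_form W s t = 1"
      by (simp add: simple_form_def)
    then show ?thesis
      using \<open>fst (wall s) \<noteq> 0\<close> True by (simp add: dot_square_norm power2_eq_square)
  next
    case False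
    have walls: "wall s \<in> simple_affine_roots" "wall t \<in> simple_affine_roots" "wall s \<noteq> wall t"
      using wall(1) assms False bij_betw_wall by (auto simp: bij_betw_def inj_on_def)
    have pow: "(s \<otimes>\<^bsub>W\<^esub> t) [^]\<^bsub>W\<^esub> n = \<one>\<^bsub>W\<^esub> \<longleftrightarrow> rotation (wall s) (wall t) ^^ n = id" for n :: nat
      using \<phi>_eq_id[of "(s \<otimes>\<^bsub>W\<^esub> t) [^]\<^bsub>W\<^esub> n"] st
      by (simp add: \<phi>_pow \<phi>st wall_reflections_funpow_eq_id)
    show ?thesis
    proof (cases "fst (wall t) = - fst (wall s)")
      case True
      then have "ord (s \<otimes>\<^bsub>W\<^esub> t) = 0"
        using rotation_order_antiparallel[OF walls True] pow ord_eq_0 st by auto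
      moreover have "fst (wall s) \<noteq> 0"
        using wall_affine_root[OF assms(1)] fst_affine_root_nonzero by blast
      ultimately show ?thesis
        using True by (simp add: simple_form_def dot_square_norm power2_eq_square)
    next
      case False
      then obtain m where m: "m > 0" "\<forall>n. rotation (wall s) (wall t) ^^ n = id \<longleftrightarrow> m dvd n"
        "fst (wall s) \<bullet> fst (wall t) / (norm (fst (wall s)) * norm (fst (wall t))) = - cos (pi / real m)"
        using rotation_order[OF walls] by blast
      then have "ord (s \<otimes>\<^bsub>W\<^esub> t) = m"
        using pow ord_unique st by auto
      then show ?thesis
        using m by (simp add: simple_form_def)
    qed
  qed
qed

section \<open>The dictionary between affine roots and roots of the Coxeter system\<close>

text \<open>Simple roots of the Coxeter system have length 1, so a wall \<open>b\<close> stands for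
  \<open>norm (fst b)\<close> times its simple root, and the result is normalised by the length of
  the linear part of \<open>f\<close>. Reflections preserve that length, which keeps the map
  equivariant although it is not linear.\<close>

definition to_root :: "'a \<times> real \<Rightarrow> 'g \<Rightarrow> real" where
  "to_root f s = (if s \<in> S then affine_coord f (wall s) * norm (fst (wall s)) / norm (fst f) else 0)"

lemma norm_affine_root_pos: "f \<in> affine_roots \<Longrightarrow> 0 < norm (fst f)"
  using fst_affine_root_nonzero by simp

lemma to_root_wall:
  assumes "s \<in> S" shows "to_root (wall s) = simple_root s"
proof
  fix t
  have "t \<in> S \<Longrightarrow> wall t = wall s \<longleftrightarrow> t = s"
    using bij_betw_wall assms by (auto simp: bij_betw_def inj_on_def)
  then show "to_root (wall s) t = simple_root s t"
    using assms norm_affine_root_pos[OF wall_affine_root[OF assms]]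
    by (auto simp: to_root_def simple_root_def affine_coord_simple wall(1))
qed

text \<open>Summing over the walls reassembles the linear part of \<open>f\<close> from its
  expansion, so the Coxeter form becomes the cosine of an angle.\<close>

lemma coxeter_form_to_root:
  assumes "s \<in> S" "f \<in> affine_roots"
  shows "coxeter_form W S (to_root f) (simple_root s) =
    fst f \<bullet> fst (wall s) / (norm (fst f) * norm (fst (wall s)))"
proof -
  have "coxeter_form W S (to_root f) (simple_root s) = (\<Sum>t\<in>S. to_root f t * simple_form W t s)"
    unfolding coxeter_form_def simple_root_def
    using assms(1) finite_S by (simp add: if_distrib[of "\<lambda>x. _ * x * _"] cong: if_cong)
  also have "\<dots> = (\<Sum>t\<in>S. affine_coord f (wall t) * (fst (wall t) \<bullet> fst (wall s)) /
      (norm (fst f) * norm (fst (wall s))))"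
  proof (rule sum.cong[OF refl])
    fix t assume "t \<in> S"
    then show "to_root f t * simple_form W t s = affine_coord f (wall t) * (fst (wall t) \<bullet> fst (wall s)) /
      (norm (fst f) * norm (fst (wall s)))"
      using norm_affine_root_pos[OF wall_affine_root] assms(1)
      by (simp add: to_root_def simple_form_wall)
  qed
  also have "\<dots> = (\<Sum>b\<in>simple_affine_roots. affine_coord f b * (fst b \<bullet> fst (wall s)) /
      (norm (fst f) * norm (fst (wall s))))"
    by (rule sum.reindex_bij_betw[OF bij_betw_wall])
  also have "\<dots> = (\<Sum>b\<in>simple_affine_roots. affine_coord f b * (fst b \<bullet> fst (wall s))) /
      (norm (fst f) * norm (fst (wall s)))"
    by (simp add: sum_divide_distrib)
  also have "(\<Sum>b\<in>simple_affine_roots. affine_coord f b * (fst b \<bullet> fst (wall s))) =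
      fst (\<Sum>b\<in>simple_affine_roots. affine_coord f b *\<^sub>R b) \<bullet> fst (wall s)"
    by (simp add: fst_sum inner_sum_left)
  finally show ?thesis
    unfolding affine_coord_expansion[OF assms(2)] .
qed

text \<open>Both sides change only the coordinate at \<open>s\<close>: one by twice the cosine, the
  other by the Cartan number rescaled by the two lengths.\<close>

lemma simple_reflection_to_root:
  assumes "s \<in> S" "f \<in> affine_roots"
  shows "simple_reflection W S s (to_root f) = to_root (reflect (wall s) f)"
proof
  fix t
  have t: "t \<in> S \<Longrightarrow> wall t = wall s \<longleftrightarrow> t = s"
    using bij_betw_wall assms by (auto simp: bij_betw_def inj_on_def)
  have pos: "0 < norm (fst (wall s))" "0 < norm (fst f)"
    using norm_affine_root_pos wall_affine_root assms by blast+
  have "pairing f (wall s) * norm (fst (wall s)) / norm (fst f) =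
      2 * (fst f \<bullet> fst (wall s) / (norm (fst f) * norm (fst (wall s))))"
    using pos by (simp add: pairing_def dot_square_norm power2_eq_square)
  moreover have "simple_reflection W S s (to_root f) t =
      to_root f t - 2 * (fst f \<bullet> fst (wall s) / (norm (fst f) * norm (fst (wall s)))) * simple_root s t"
    by (simp add: simple_reflection_def coxeter_form_to_root[OF assms])
  ultimately show "simple_reflection W S s (to_root f) t = to_root (reflect (wall s) f) t"
    using assms t
    by (auto simp: to_root_def simple_root_def
        norm_reflect[OF wall_affine_root] affine_coord_reflect wall(1) left_diff_distrib diff_divide_distrib)
qed

lemma foldr_simple_reflection_to_root:
  assumes "set ws \<subseteq> S" "f \<in> affine_roots"
  shows "foldr (simple_reflection W S) ws (to_root f) = to_root (foldr reflect (map wall ws) f)"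
  using assms(1)
proof (induction ws)
  case (Cons s ws)
  have "set (map wall ws) \<subseteq> simple_affine_roots"
    using Cons.prems wall(1) by auto
  then have "foldr reflect (map wall ws) f \<in> affine_roots"
    using foldr_reflect_affine_root assms(2) by blast
  then show ?case
    using Cons simple_reflection_to_root[of s] by simp
qed simp

lemma word_product:
  assumes "set ws \<subseteq> S"
  shows "foldr (\<lambda>s x. s \<otimes>\<^bsub>W\<^esub> x) ws \<one>\<^bsub>W\<^esub> \<in> carrier W"
    "\<phi> (foldr (\<lambda>s x. s \<otimes>\<^bsub>W\<^esub> x) ws \<one>\<^bsub>W\<^esub>) = foldr wall_reflection (map wall ws)"
proof -
  interpret group W by (rule group_W)
  have "foldr (\<lambda>s x. s \<otimes>\<^bsub>W\<^esub> x) ws \<one>\<^bsub>W\<^esub> \<in> carrier W \<and>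
    \<phi> (foldr (\<lambda>s x. s \<otimes>\<^bsub>W\<^esub> x) ws \<one>\<^bsub>W\<^esub>) = foldr wall_reflection (map wall ws)"
    using assms
  proof (induction ws)
    case Nil
    then show ?case
      using \<phi>_one by simp
  next
    case (Cons s ws)
    moreover have "s \<in> carrier W"
      using Cons.prems S_subset by auto
    ultimately show ?case
      using \<phi>_mult wall(2) by simp
  qed
  then show "foldr (\<lambda>s x. s \<otimes>\<^bsub>W\<^esub> x) ws \<one>\<^bsub>W\<^esub> \<in> carrier W"
    "\<phi> (foldr (\<lambda>s x. s \<otimes>\<^bsub>W\<^esub> x) ws \<one>\<^bsub>W\<^esub>) = foldr wall_reflection (map wall ws)"
    by auto
qed

lemma wall_word:
  assumes "set as \<subseteq> simple_affine_roots"
  obtains ws where "set ws \<subseteq> S" "map wall ws = as"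
proof
  let ?ws = "map (inv_into S wall) as"
  have im: "wall ` S = simple_affine_roots"
    using bij_betw_wall by (simp add: bij_betw_def)
  then show "set ?ws \<subseteq> S"
    using assms by (auto intro!: inv_into_into)
  show "map wall ?ws = as"
    using assms im by (auto simp: f_inv_into_f intro!: map_idI)
qed

text \<open>Secures the choice of a word in the definition of \<open>act\<close>.\<close>

lemma exists_word:
  assumes "w \<in> carrier W"
  shows "\<exists>ws. ws \<in> lists S \<and> foldr (\<lambda>s x. s \<otimes>\<^bsub>W\<^esub> x) ws \<one>\<^bsub>W\<^esub> = w"
proof -
  obtain as where as: "set as \<subseteq> simple_affine_roots" "\<phi> w = foldr wall_reflection as"
    using affine_weyl_group_word[OF \<phi>_carrier[OF assms]] by blast
  obtain ws where ws: "set ws \<subseteq> S" "map wall ws = as"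
    using wall_word[OF as(1)] .
  then have "\<phi> (foldr (\<lambda>s x. s \<otimes>\<^bsub>W\<^esub> x) ws \<one>\<^bsub>W\<^esub>) = \<phi> w"
    using word_product as(2) by simp
  then have "foldr (\<lambda>s x. s \<otimes>\<^bsub>W\<^esub> x) ws \<one>\<^bsub>W\<^esub> = w"
    using \<phi>_inj word_product(1)[OF ws(1)] assms by (meson inj_onD)
  then show ?thesis
    using ws(1) by (auto simp: lists_eq_set)
qed

text \<open>\<open>act\<close> uses an unknown word, but the evaluation identity determines
  \<open>g\<close> from \<open>f\<close> and \<phi> w, so later arguments never see the
  word.\<close>

lemma act_to_root:
  assumes "w \<in> carrier W" "f \<in> affine_roots"
  obtains g where "g \<in> affine_roots" "act W S w (to_root f) = to_root g"
    "\<And>x. affine_eval g (\<phi> w x) = affine_eval f x"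
proof -
  define ws where "ws = (SOME ws. ws \<in> lists S \<and> foldr (\<lambda>s x. s \<otimes>\<^bsub>W\<^esub> x) ws \<one>\<^bsub>W\<^esub> = w)"
  have "ws \<in> lists S \<and> foldr (\<lambda>s x. s \<otimes>\<^bsub>W\<^esub> x) ws \<one>\<^bsub>W\<^esub> = w"
    unfolding ws_def using exists_word[OF assms(1)] by (rule someI_ex)
  then have ws: "set ws \<subseteq> S" "foldr (\<lambda>s x. s \<otimes>\<^bsub>W\<^esub> x) ws \<one>\<^bsub>W\<^esub> = w"
    by (auto simp: lists_eq_set)
  let ?g = "foldr reflect (map wall ws) f"
  have walls: "set (map wall ws) \<subseteq> simple_affine_roots"
    using ws(1) wall(1) by auto
  have "?g \<in> affine_roots"
    using foldr_reflect_affine_root[OF walls assms(2)] .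
  moreover have "act W S w (to_root f) = to_root ?g"
    unfolding act_def ws_def[symmetric] using foldr_simple_reflection_to_root[OF ws(1) assms(2)] .
  moreover have "affine_eval ?g (\<phi> w x) = affine_eval f x" for x
    using affine_eval_foldr[OF walls] word_product(2)[OF ws(1)] ws(2) by simp
  ultimately show thesis
    using that by blast
qed

text \<open>Equal images make \<open>f\<close> a positive multiple of \<open>g\<close>, the ratio of
  lengths undoing the normalisation. Reducedness leaves only \<open>g\<close> and -g, and the
  positive factor excludes -g.\<close>

lemma to_root_inject:
  assumes "f \<in> affine_roots" "g \<in> affine_roots" "to_root f = to_root g"
  shows "f = g"
proof -
  have pos: "0 < norm (fst f)" "0 < norm (fst g)"
    using norm_affine_root_pos assms by auto
  let ?c = "norm (fst f) / norm (fst g)"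
  have "affine_coord f b = ?c * affine_coord g b" if b: "b \<in> simple_affine_roots" for b
  proof -
    obtain s where s: "s \<in> S" "b = wall s"
      using b bij_betw_wall by (auto simp: bij_betw_def)
    then show ?thesis
      using fun_cong[OF assms(3), of s] norm_affine_root_pos[OF wall_affine_root[OF s(1)]] pos
      by (simp add: to_root_def field_simps)
  qed
  then have "(\<Sum>b\<in>simple_affine_roots. affine_coord f b *\<^sub>R b) =
      ?c *\<^sub>R (\<Sum>b\<in>simple_affine_roots. affine_coord g b *\<^sub>R b)"
    unfolding scaleR_sum_right by (intro sum.cong) auto
  then have fg: "f = ?c *\<^sub>R g"
    unfolding affine_coord_expansion[OF assms(1)] affine_coord_expansion[OF assms(2)] .
  then have "f = g \<or> f = - g"
    using proportional_affine_roots[OF assms(1,2)] by blast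
  moreover have "f \<noteq> - g"
  proof
    assume "f = - g"
    then have "?c = 1"
      using pos by simp
    then have "f = g"
      using fg by (metis scaleR_one)
    then have "2 *\<^sub>R fst g = 0"
      using \<open>f = - g\<close> by (simp add: scaleR_2 prod_eq_iff flip: eq_neg_iff_add_eq_0)
    then show False
      using pos by simp
  qed
  ultimately show ?thesis
    by blast
qed

lemma roots_eq: "roots W S = to_root ` affine_roots"
proof (intro equalityI subsetI)
  fix \<beta> assume "\<beta> \<in> roots W S"
  then obtain w s where "w \<in> carrier W" "s \<in> S" "\<beta> = act W S w (to_root (wall s))"
    by (auto simp: roots_def to_root_wall)
  then show "\<beta> \<in> to_root ` affine_roots"
    using act_to_root[of w "wall s"] wall_affine_root by (metis imageI)
next
  fix \<beta> assume "\<beta> \<in> to_root ` affine_roots"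
  then obtain f where f: "f \<in> affine_roots" "\<beta> = to_root f"
    by blast
  obtain as a where as: "set as \<subseteq> simple_affine_roots" "a \<in> simple_affine_roots" "f = foldr reflect as a"
    using affine_root_in_orbit[OF f(1)] by blast
  obtain s where s: "s \<in> S" "a = wall s"
    using as(2) bij_betw_wall by (auto simp: bij_betw_def)
  obtain ws where ws: "set ws \<subseteq> S" "map wall ws = as"
    using wall_word[OF as(1)] .
  define w where "w = foldr (\<lambda>s x. s \<otimes>\<^bsub>W\<^esub> x) ws \<one>\<^bsub>W\<^esub>"
  have w: "w \<in> carrier W" "\<phi> w = foldr wall_reflection as"
    unfolding w_def using word_product[OF ws(1)] ws(2) by auto
  obtain g where g: "g \<in> affine_roots" "act W S w (to_root a) = to_root g"
    "\<And>x. affine_eval g (\<phi> w x) = affine_eval a x"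
    using act_to_root[OF w(1) simple_affine_root[OF as(2)]] by blast
  \<comment> \<open>The word chosen inside \<open>act\<close> may differ from \<open>ws\<close>, so
    \<open>g\<close> is identified with \<open>f\<close> through values: both arise from
    \<open>a\<close> by the same bijection \<phi> w.\<close>
  have "affine_eval g y = affine_eval f y" for y
  proof -
    have "y \<in> range (\<phi> w)"
      unfolding w(2) using foldr_wall_reflection_Bij[OF as(1)] by (auto simp: Bij_def bij_def)
    then obtain x where "y = \<phi> w x"
      by blast
    then show ?thesis
      using g(3) affine_eval_foldr[OF as(1)] w(2) as(3) by simp
  qed
  then have "g = f"
    using affine_eval_inject by blast
  then show "\<beta> \<in> roots W S"
    using g(2) f(2) s w(1) to_root_wall unfolding roots_def by (metis (mono_tags, lifting) mem_Collect_eq)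
qed

lemma to_root_nonneg_iff:
  assumes "f \<in> affine_roots"
  shows "(\<forall>s\<in>S. 0 \<le> to_root f s) \<longleftrightarrow> f \<in> positive_affine_roots"
proof -
  have "0 \<le> to_root f s \<longleftrightarrow> 0 \<le> affine_coord f (wall s)" if "s \<in> S" for s
    using that norm_affine_root_pos[OF assms] norm_affine_root_pos[OF wall_affine_root[OF that]]
    by (simp add: to_root_def zero_le_divide_iff zero_le_mult_iff)
  then show ?thesis
    using assms bij_betw_imp_surj_on[OF bij_betw_wall, symmetric]
    by (simp add: positive_affine_roots_def)
qed

lemma positive_roots_eq: "positive_roots W S = to_root ` positive_affine_roots"
  using to_root_nonneg_iff positive_affine_roots_subset unfolding positive_roots_def roots_eq by blast

lemma to_root_positive_iff:
  "f \<in> affine_roots \<Longrightarrow> to_root f \<in> positive_roots W S \<longleftrightarrow> f \<in> positive_affine_roots"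
  using to_root_nonneg_iff unfolding positive_roots_def roots_eq by blast

lemma is_negative_to_root:
  assumes "f \<in> affine_roots"
  shows "is_negative W S (to_root f) \<longleftrightarrow> f \<notin> positive_affine_roots"
proof -
  have "(\<lambda>s. - to_root f s) = to_root (- f)"
    by (rule ext) (simp add: to_root_def affine_coord_uminus)
  then have "is_negative W S (to_root f) \<longleftrightarrow> - f \<in> positive_affine_roots"
    unfolding is_negative_def using to_root_positive_iff[OF uminus_affine_root[OF assms]] by simp
  then show ?thesis
    using affine_root_sign[OF assms] positive_affine_roots_antisym by blast
qed

end

section \<open>Generic directions\<close>

lemma exists_nonorthogonal:
  fixes F :: "'a::euclidean_space set"
  assumes "finite F" "0 \<notin> F"
  shows "\<exists>v. \<forall>y\<in>F. y \<bullet> v \<noteq> 0"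
  using assms
proof (induction rule: finite_induct)
  case (insert z F)
  then obtain v where v: "\<forall>y\<in>F. y \<bullet> v \<noteq> 0"
    by auto
  \<comment> \<open>The values of \<open>t\<close> for which z + t v is orthogonal to some y with y
    \<bullet> v nonzero. If z \<bullet> v = 0, the last entry is a harmless division by zero, and z
    \<bullet> (z + t v) is z \<bullet> z for every \<open>t\<close>.\<close>
  have "finite ((\<lambda>y. - (y \<bullet> z) / (y \<bullet> v)) ` F \<union> {- (z \<bullet> z) / (z \<bullet> v)})"
    using insert by simp
  then obtain t where t: "t \<notin> (\<lambda>y. - (y \<bullet> z) / (y \<bullet> v)) ` F \<union> {- (z \<bullet> z) / (z \<bullet> v)}"
    using ex_new_if_finite[OF infinite_UNIV_char_0] by blast
  have "y \<bullet> (z + t *\<^sub>R v) \<noteq> 0" if "y \<in> insert z F" for y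
  proof
    assume eq: "y \<bullet> (z + t *\<^sub>R v) = 0"
    show False
    proof (cases "y \<bullet> v = 0")
      case True
      then have "y = z"
        using v that by blast
      then show False
        using eq True insert.prems by (simp add: inner_add_right)
    next
      case False
      then have "t = - (y \<bullet> z) / (y \<bullet> v)"
        using eq by (simp add: inner_add_right field_simps)
      then show False
        using t that by auto
    qed
  qed
  then show ?case
    by blast
qed simp

context based_root_system
begin

text \<open>Project the other roots to the hyperplane orthogonal to \<alpha>. No projection vanishes
  because \<open>R\<close> is reduced, so some v is orthogonal to none of them, and the self-adjoint
  projection can be moved onto v.\<close>

lemma generic_orthogonal_direction:
  assumes "\<alpha> \<in> R"
  shows "\<exists>v. \<alpha> \<bullet> v = 0 \<and> (\<forall>\<gamma>\<in>R - {\<alpha>, - \<alpha>}. \<gamma> \<bullet> v \<noteq> 0)"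
proof -
  define proj where "proj y = y - (y \<bullet> \<alpha> / (\<alpha> \<bullet> \<alpha>)) *\<^sub>R \<alpha>" for y
  have pos: "0 < \<alpha> \<bullet> \<alpha>"
    using inner_self_pos[OF assms] .
  have "0 \<notin> proj ` (R - {\<alpha>, - \<alpha>})"
  proof
    assume "0 \<in> proj ` (R - {\<alpha>, - \<alpha>})"
    then obtain y where "y \<in> R - {\<alpha>, - \<alpha>}" "proj y = 0"
      by (metis imageE)
    then have y: "y \<in> R" "y \<noteq> \<alpha>" "y \<noteq> - \<alpha>" "y = (y \<bullet> \<alpha> / (\<alpha> \<bullet> \<alpha>)) *\<^sub>R \<alpha>"
      by (simp_all add: proj_def)
    then show False
      using proportional_roots[OF assms, of "y \<bullet> \<alpha> / (\<alpha> \<bullet> \<alpha>)"] by (metis scaleR_minus_left scaleR_one)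
  qed
  then obtain v where v: "\<forall>y\<in>proj ` (R - {\<alpha>, - \<alpha>}). y \<bullet> v \<noteq> 0"
    using exists_nonorthogonal finite_R by (metis finite_Diff finite_imageI)
  have "proj y \<bullet> v = y \<bullet> proj v" for y
    by (simp add: proj_def inner_diff_left inner_diff_right inner_commute)
  then have "\<forall>\<gamma>\<in>R - {\<alpha>, - \<alpha>}. \<gamma> \<bullet> proj v \<noteq> 0"
    using v by simp
  moreover have "\<alpha> \<bullet> proj v = 0"
    using pos by (simp add: proj_def inner_diff_right inner_commute)
  ultimately show ?thesis
    by blast
qed

end

section \<open>Inversion sets, domination and elementary roots\<close>

context affine_coxeter
begin

lemma exists_into_alcove:
  obtains w where "w \<in> carrier W" "\<phi> (inv\<^bsub>W\<^esub> w) p \<in> alcove"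
proof -
  interpret group W by (rule group_W)
  obtain as where as: "set as \<subseteq> simple_affine_roots" "foldr wall_reflection as p \<in> alcove"
    using move_into_alcove by blast
  obtain ws where ws: "set ws \<subseteq> S" "map wall ws = as"
    using wall_word[OF as(1)] .
  define w where "w = inv\<^bsub>W\<^esub> (foldr (\<lambda>s x. s \<otimes>\<^bsub>W\<^esub> x) ws \<one>\<^bsub>W\<^esub>)"
  have "w \<in> carrier W" "\<phi> (inv\<^bsub>W\<^esub> w) p \<in> alcove"
    unfolding w_def using word_product[OF ws(1)] as(2) ws(2) by simp_all
  then show thesis
    using that by blast
qed

lemma inversion_set_subset: "inversion_set W S w \<subseteq> to_root ` positive_affine_roots"
  unfolding inversion_set_def positive_roots_eq by blast

text \<open>The inverse of \<open>w\<close> carries \<open>p\<close> into the closed alcove, where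
  affine roots have only weak signs. Strict signs at \<open>p\<close> therefore decide membership,
  while the value 0 is left open: \<open>p\<close> may lie on the hyperplane of
  \<open>f\<close>.\<close>

lemma inversion_set_separates:
  assumes "w \<in> carrier W" "\<phi> (inv\<^bsub>W\<^esub> w) p \<in> alcove" "f \<in> positive_affine_roots"
  shows "affine_eval f p < 0 \<Longrightarrow> to_root f \<in> inversion_set W S w"
    and "0 < affine_eval f p \<Longrightarrow> to_root f \<notin> inversion_set W S w"
proof -
  have f: "f \<in> affine_roots"
    using assms(3) positive_affine_roots_subset by blast
  have "inv\<^bsub>W\<^esub> w \<in> carrier W"
    using assms(1) group.inv_closed[OF group_W] by blast
  then obtain g where g: "g \<in> affine_roots" "act W S (inv\<^bsub>W\<^esub> w) (to_root f) = to_root g"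
    "affine_eval g (\<phi> (inv\<^bsub>W\<^esub> w) p) = affine_eval f p"
    using act_to_root[OF _ f] by metis
  have mem: "to_root f \<in> inversion_set W S w \<longleftrightarrow> g \<notin> positive_affine_roots"
    unfolding inversion_set_def g(2)
    using is_negative_to_root[OF g(1)] assms(3) positive_roots_eq g(2) by auto
  show "to_root f \<in> inversion_set W S w" if "affine_eval f p < 0"
    using mem positive_on_alcove[OF _ assms(2), of g] g(3) that by auto
  show "to_root f \<notin> inversion_set W S w" if "0 < affine_eval f p"
  proof
    assume "to_root f \<in> inversion_set W S w"
    then have "- g \<in> positive_affine_roots"
      using mem affine_root_sign[OF g(1)] by blast
    then have "0 \<le> affine_eval (- g) (\<phi> (inv\<^bsub>W\<^esub> w) p)"
      using positive_on_alcove assms(2) by blast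
    then show False
      using g(3) that by (simp add: affine_eval_def)
  qed
qed

text \<open>The images of the two functions still differ by the constant 1. A negative image of
  \<open>f\<close> has constant part at most 0; lowered by 1 it is below 0, which no positive root
  allows.\<close>

lemma dominates_translate:
  assumes "f \<in> affine_roots" "f - (0, 1) \<in> affine_roots"
  shows "dominates W S (to_root f) (to_root (f - (0, 1)))"
  unfolding dominates_def
proof (intro ballI impI)
  fix w assume w: "w \<in> carrier W" and neg: "is_negative W S (act W S (inv\<^bsub>W\<^esub> w) (to_root f))"
  let ?v = "inv\<^bsub>W\<^esub> w"
  have v: "?v \<in> carrier W"
    using w group.inv_closed[OF group_W] by blast
  obtain g where g: "g \<in> affine_roots" "act W S ?v (to_root f) = to_root g"
    "\<And>x. affine_eval g (\<phi> ?v x) = affine_eval f x"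
    using act_to_root[OF v assms(1)] by blast
  obtain h where h: "h \<in> affine_roots" "act W S ?v (to_root (f - (0, 1))) = to_root h"
    "\<And>x. affine_eval h (\<phi> ?v x) = affine_eval (f - (0, 1)) x"
    using act_to_root[OF v assms(2)] by blast
  \<comment> \<open>At the point \<phi> w 0 the evaluation identities read off the constant parts of
    \<open>g\<close> and \<open>h\<close>.\<close>
  have "\<phi> ?v (\<phi> w 0) = 0"
    using \<phi>_inv[OF w] .
  then have "snd h = snd g - 1"
    using g(3)[of "\<phi> w 0"] h(3)[of "\<phi> w 0"] by (simp add: affine_eval_def)
  moreover have "- g \<in> positive_affine_roots"
    using neg g(1,2) is_negative_to_root affine_root_sign by metis
  then have "snd g \<le> 0"
    using snd_positive_nonneg by fastforce
  ultimately have "h \<notin> positive_affine_roots"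
    using snd_positive_nonneg[of h] by auto
  then show "is_negative W S (act W S ?v (to_root (f - (0, 1))))"
    using h is_negative_to_root by simp
qed

lemma elementary_not_translate:
  assumes "f \<in> positive_affine_roots" "to_root f \<in> elementary_roots W S"
  shows "f - (0, 1) \<notin> positive_affine_roots"
proof
  assume pos: "f - (0, 1) \<in> positive_affine_roots"
  have aff: "f \<in> affine_roots" "f - (0, 1) \<in> affine_roots"
    using assms(1) pos positive_affine_roots_subset by auto
  have "f - (0, 1) \<noteq> f"
    by (simp add: prod_eq_iff)
  then have "to_root (f - (0, 1)) \<noteq> to_root f"
    using to_root_inject aff by blast
  then show False
    using assms(2) pos dominates_translate[OF aff] positive_roots_eq unfolding elementary_roots_def by blast
qed

lemma elementary_is_super_elementary:
  assumes "\<beta> \<in> elementary_roots W S"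
  shows "\<beta> \<in> super_elementary_roots W S"
proof -
  have \<beta>: "\<beta> \<in> positive_roots W S"
    using assms by (simp add: elementary_roots_def)
  then obtain f where f: "f \<in> positive_affine_roots" "\<beta> = to_root f"
    using positive_roots_eq by blast
  then have aff: "f \<in> affine_roots"
    using positive_affine_roots_subset by blast
  define \<gamma> where "\<gamma> = fst f"
  have \<gamma>: "\<gamma> \<in> R" "0 < \<gamma> \<bullet> \<gamma>"
    unfolding \<gamma>_def using fst_affine_root fst_affine_root_pos aff by auto
  have notpos: "f - (0, 1) \<notin> positive_affine_roots"
    using elementary_not_translate f assms by blast
  have "f - (0, 1) \<in> affine_roots"
    using aff by (auto simp: affine_roots_def mem_Times_iff)
  then have "- (f - (0, 1)) \<in> positive_affine_roots"
    using notpos affine_root_sign by blast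
  \<comment> \<open>The constant part of a positive root is nonnegative, here 1 - k. With
    \<open>k0\<close> this leaves k = 0 or k = 1.\<close>
  then have k1: "snd f \<le> 1"
    using snd_positive_nonneg by fastforce
  have k0: "0 \<le> snd f"
    using snd_positive_nonneg f(1) by blast
  obtain v where v: "\<gamma> \<bullet> v = 0" "\<And>\<delta>. \<delta> \<in> R \<Longrightarrow> \<delta> \<noteq> \<gamma> \<Longrightarrow> \<delta> \<noteq> - \<gamma> \<Longrightarrow> \<delta> \<bullet> v \<noteq> 0"
    using generic_orthogonal_direction[OF \<gamma>(1)] by blast
  \<comment> \<open>At \<open>q\<close> the function \<gamma> + j has the value j - k - 1/2. The
    half puts \<open>q\<close> midway between the hyperplanes of \<gamma> + k and \<gamma> + (k +
    1), so \<open>f\<close> is negative there and the next function is positive.\<close>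
  define q where "q = (- (snd f + 1 / 2) / (\<gamma> \<bullet> \<gamma>)) *\<^sub>R \<gamma>"
  have \<gamma>q: "\<gamma> \<bullet> q = - (snd f + 1 / 2)"
    using \<gamma>(2) by (simp add: q_def)
  let ?R' = "R - {\<gamma>, - \<gamma>}"
  \<comment> \<open>A sum of absolute values bounds each of its terms, and the added 1 makes the
    shift t (\<delta> \<bullet> v) strictly larger than \<delta> \<bullet> q in absolute value.
    Since the shifts at the two points are opposite, one of the two values is positive.\<close>
  define t where "t = (\<Sum>\<delta>\<in>?R'. \<bar>(\<bar>\<delta> \<bullet> q\<bar> + 1) / (\<delta> \<bullet> v)\<bar>)"
  have t: "\<bar>\<delta> \<bullet> q\<bar> < \<bar>t * (\<delta> \<bullet> v)\<bar>" if "\<delta> \<in> ?R'" for \<delta>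
  proof -
    have "\<bar>(\<bar>\<delta> \<bullet> q\<bar> + 1) / (\<delta> \<bullet> v)\<bar> \<le> t"
      unfolding t_def using that finite_R
      by (intro member_le_sum[where f = "\<lambda>\<delta>. \<bar>(\<bar>\<delta> \<bullet> q\<bar> + 1) / (\<delta> \<bullet> v)\<bar>"]) auto
    moreover have "0 < \<bar>\<delta> \<bullet> v\<bar>"
      using v(2) that by simp
    ultimately have "\<bar>\<delta> \<bullet> q\<bar> + 1 \<le> t * \<bar>\<delta> \<bullet> v\<bar>" "0 \<le> t"
      by (simp_all add: abs_divide field_simps t_def sum_nonneg)
    then show ?thesis
      by (simp add: abs_mult)
  qed
  have separated: "0 < affine_eval g (q + t *\<^sub>R v) \<or> 0 < affine_eval g (q - t *\<^sub>R v)"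
    if g: "g \<in> positive_affine_roots" "g \<noteq> f" for g
  proof -
    have gaff: "g \<in> affine_roots" and gk: "0 \<le> snd g"
      using g positive_affine_roots_subset snd_positive_nonneg by auto
    have gR: "fst g \<in> R"
      using fst_affine_root gaff by blast
    have eval: "affine_eval g (q + t *\<^sub>R v) = fst g \<bullet> q + t * (fst g \<bullet> v) + snd g"
      "affine_eval g (q - t *\<^sub>R v) = fst g \<bullet> q - t * (fst g \<bullet> v) + snd g"
      by (simp_all add: affine_eval_def inner_add_right inner_diff_right)
    consider "fst g = - \<gamma>" | "fst g = \<gamma>" | "fst g \<in> ?R'"
      using gR by blast
    then show ?thesis
    proof cases
      \<comment> \<open>Here \<open>g\<close> is -\<gamma> + j, with the value j + k + 1/2 at both
        points.\<close>
      case 1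
      then show ?thesis
        unfolding eval using \<gamma>q v(1) k0 gk by simp
    next
      case 2
      obtain i j :: int where ij: "snd f = of_int i" "snd g = of_int j"
        using aff gaff by (metis Ints_cases affine_roots_def mem_Times_iff)
      have "j \<noteq> i"
        using g(2) 2 ij by (auto simp: \<gamma>_def prod_eq_iff)
      \<comment> \<open>Only j < i could fail, and i \<le> 1 with j \<ge> 0 reduces this to j = i -
        1, which elementarity excludes through \<open>notpos\<close>.\<close>
      moreover have "j \<noteq> i - 1"
      proof
        assume "j = i - 1"
        then have "g = f - (0, 1)"
          using 2 ij by (simp add: \<gamma>_def prod_eq_iff)
        then show False
          using g(1) notpos by blast
      qed
      moreover have "0 \<le> j" "i \<le> 1"
        using ij gk k1 by auto
      ultimately have "i + 1 \<le> j"
        by linarith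
      then have "snd f + 1 \<le> snd g"
        using ij by linarith
      then show ?thesis
        unfolding eval using 2 \<gamma>q v(1) by simp
    next
      case 3
      then show ?thesis
        unfolding eval using t[OF 3] gk by linarith
    qed
  qed
  obtain x where x: "x \<in> carrier W" "\<phi> (inv\<^bsub>W\<^esub> x) (q + t *\<^sub>R v) \<in> alcove"
    using exists_into_alcove .
  obtain y where y: "y \<in> carrier W" "\<phi> (inv\<^bsub>W\<^esub> y) (q - t *\<^sub>R v) \<in> alcove"
    using exists_into_alcove .
  have "affine_eval f (q + t *\<^sub>R v) < 0" "affine_eval f (q - t *\<^sub>R v) < 0"
    using \<gamma>q v(1) by (simp_all add: affine_eval_def \<gamma>_def inner_add_right inner_diff_right)
  then have "\<beta> \<in> inversion_set W S x \<inter> inversion_set W S y"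
    using inversion_set_separates(1)[OF x f(1)] inversion_set_separates(1)[OF y f(1)] f(2) by simp
  moreover have "inversion_set W S x \<inter> inversion_set W S y \<subseteq> {\<beta>}"
    using separated inversion_set_separates(2)[OF x] inversion_set_separates(2)[OF y]
      inversion_set_subset f(2) by blast
  ultimately have "inversion_set W S x \<inter> inversion_set W S y = {\<beta>}"
    by blast
  then show ?thesis
    unfolding super_elementary_roots_def using \<beta> x(1) y(1) by blast
qed

end

lemma super_elementary_is_elementary:
  "super_elementary_roots W S \<subseteq> elementary_roots W S"
proof
  fix \<beta> assume "\<beta> \<in> super_elementary_roots W S"
  then obtain x y where xy: "\<beta> \<in> positive_roots W S" "x \<in> carrier W" "y \<in> carrier W"
    "inversion_set W S x \<inter> inversion_set W S y = {\<beta>}"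
    by (auto simp: super_elementary_roots_def)
  have "\<alpha> = \<beta>" if "\<alpha> \<in> positive_roots W S" "dominates W S \<beta> \<alpha>" for \<alpha>
  proof -
    have "\<beta> \<in> inversion_set W S x" "\<beta> \<in> inversion_set W S y"
      using xy(4) by auto
    then have "\<alpha> \<in> inversion_set W S x \<inter> inversion_set W S y"
      using that xy(2,3) by (auto simp: inversion_set_def dominates_def)
    then show ?thesis
      using xy(4) by simp
  qed
  then show "\<beta> \<in> elementary_roots W S"
    using xy(1) by (auto simp: elementary_roots_def)
qed

theorem theorem7p6:
  fixes W :: "('g, 'b) monoid_scheme" and S :: "'g set" and R :: "'a::euclidean_space set"
  assumes "affine_coxeter_system W S R"
  shows "super_elementary_roots W S = elementary_roots W S"
proof -
  obtain D \<phi> where "crystallographic_root_system R" "simple_system R D" "group W" "S \<subseteq> carrier W"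
    "\<phi> \<in> iso W (affine_weyl_group R)" "\<phi> ` S = affine_generators R D"
    using assms unfolding affine_coxeter_system_def by blast
  then interpret affine_coxeter R D W S \<phi>
    by (intro affine_coxeter.intro based_root_system.intro affine_coxeter_axioms.intro)
  show ?thesis
    using super_elementary_is_elementary elementary_is_super_elementary by blast
qed

end
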